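(* Let $X_n=\frac{1}{\sqrt n}(a_n(p,q))_{p,q=1,\dots,n}$ be an ensemble of random hermitian matrices as described in the context, associated with equivalence relations $\sim_n$ on $[n]^2$, and assume that $$\alpha_2(n)=\max_{(p,q)\in[n]^2}\#\{(p',q')\in[n]^2 : (p,q)\sim_n(p',q')\}$$ satisfies $\alpha_2(n)=O(n^\epsilon)$ for all $\epsilon>0$. Then for every $j\ge3$ and all integers $k_1,\dots,k_j\ge1$, $$C_j\big(\operatorname{Tr}(X_n^{k_1}),\dots,\operatorname{Tr}(X_n^{k_j})\big)=o(1)\qquad (n\to\infty),$$ where $C_j$ denotes the joint cumulant of order $j$.
   Context: Ensemble: $[n]=\{1,\dots,n\}$. For each $n\in\mathbb{N}$, $\sim_n$ is an equivalence relation on $[n]^2$ with $(p,q)\sim_n(q,p)$ for all $p,q$. The entries $a_n(p,q)=\overline{a_n(q,p)}$ are complex random variables such that $a_n(p_1,q_1),\dots,a_n(p_j,q_j)$ are independent whenever $(p_1,q_1),\dots,(p_j,q_j)$ belong to $j$ distinct equivalence classes of $\sim_n$. For equivalent pairs $(p,q)\sim_n(p',q')$ the relation between $a_n(p,q)$ and $a_n(p',q')$ is not specified; these variables may be identical or correlated. The entries are centered, $\mathbb{E}(a_n(p,q))=0$, satisfy $m_k=\sup_n\max_{p,q}\mathbb{E}(|a_n(p,q)|^k)<\infty$ for all $k\in\mathbb{N}$, and there is a fixed $s>0$ with $\mathbb{E}(|a_n(p,q)|^2)=s^2$ for all $p\ne q$. Joint cumulants: for complex random variables $Y_1,\dots,Y_j$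 with finite $j$-th moments, $$C_j(Y_1,\dots,Y_j)=\sum_{\pi}(-1)^{\#\pi-1}(\#\pi-1)!\prod_{l=1}^{\#\pi}\mathbb{E}\Big(\prod_{i\in B_l}Y_i\Big),$$ the sum running over all partitions $\pi=\{B_1,\dots,B_{\#\pi}\}$ of $\{1,\dots,j\}$ into $\#\pi$ blocks.
   Formalization: Independence is assumed for the whole families of entries of distinct equivalence classes, not only for choices of one entry per class; with the latter alone the claim fails, since a common random sign can couple the classes. *)

theory Defs
  imports "HOL-Probability.Probability" "Jordan_Normal_Form.Matrix"
begin

text \<open>
  An equivalence relation on \<open>[n]\<^sup>2\<close> is a set of pairs of positions, \<open>[n]\<close> being \<open>{1..n}\<close>.
  The underlying probability space \<open>M n\<close> may depend on \<open>n\<close>.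

  The independence assumption says that the families
  \<open>(a n x)\<^bsub>x \<in> c\<^esub>\<close>, indexed by the equivalence classes \<open>c\<close>, are independent. Within a class nothing
  is assumed. Merely requiring that each choice of one entry per class is independent would
  not suffice: let \<open>Y c\<close> be independent fair signs indexed by the classes and \<open>W\<close> one more such
  sign; if every entry is \<open>Y c\<close> or \<open>W * Y c\<close>, all such choices are independent, but the
  common factor \<open>W\<close> can give the traces non-Gaussian fluctuations.
\<close>

locale correlated_ensemble =
  fixes M :: "nat \<Rightarrow> 'w measure"
    and a :: "nat \<Rightarrow> nat \<times> nat \<Rightarrow> 'w \<Rightarrow> complex"
    and R :: "nat \<Rightarrow> ((nat \<times> nat) \<times> (nat \<times> nat)) set"
    and s :: real
  assumes prob: "n \<ge> 1 \<Longrightarrow> prob_space (M n)"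
    and equiv_R: "n \<ge> 1 \<Longrightarrow> equiv ({1..n} \<times> {1..n}) (R n)"
    and R_swap: "n \<ge> 1 \<Longrightarrow> p \<in> {1..n} \<Longrightarrow> q \<in> {1..n} \<Longrightarrow> ((p, q), (q, p)) \<in> R n"
    and hermitian: "n \<ge> 1 \<Longrightarrow> p \<in> {1..n} \<Longrightarrow> q \<in> {1..n} \<Longrightarrow> \<omega> \<in> space (M n) \<Longrightarrow>
          a n (p, q) \<omega> = cnj (a n (q, p) \<omega>)"
    and indep_classes: "n \<ge> 1 \<Longrightarrow>
          prob_space.indep_vars (M n) (\<lambda>c. \<Pi>\<^sub>M x\<in>c. borel) (\<lambda>c \<omega>. \<lambda>x\<in>c. a n x \<omega>)
            (({1..n} \<times> {1..n}) // R n)"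
    and centered: "n \<ge> 1 \<Longrightarrow> p \<in> {1..n} \<Longrightarrow> q \<in> {1..n} \<Longrightarrow>
          (\<integral>\<omega>. a n (p, q) \<omega> \<partial>M n) = 0"
    and moments: "(SUP n\<in>{1..}. MAX x\<in>{1..n} \<times> {1..n}.
          \<integral>\<^sup>+\<omega>. ennreal (cmod (a n x \<omega>) ^ k) \<partial>M n) < \<infinity>"
    and s_pos: "s > 0"
    and variance: "n \<ge> 1 \<Longrightarrow> p \<in> {1..n} \<Longrightarrow> q \<in> {1..n} \<Longrightarrow> p \<noteq> q \<Longrightarrow>
          (\<integral>\<omega>. (cmod (a n (p, q) \<omega>))\<^sup>2 \<partial>M n) = s\<^sup>2"

lemma (in prob_space) indep_vars_reindex_inj:
  assumes inj: "inj_on f J" and X: "indep_vars N X (f ` J)"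
  shows "indep_vars (\<lambda>i. N (f i)) (\<lambda>i. X (f i)) J"
  unfolding indep_vars_def2
proof (intro conjI ballI)
  fix i assume "i \<in> J"
  then show "random_variable (N (f i)) (X (f i))"
    using X by (simp add: indep_vars_def2)
next
  let ?F = "\<lambda>i. {X i -` A \<inter> space M |A. A \<in> sets (N i)}"
  have F: "indep_sets ?F (f ` J)"
    using X by (simp add: indep_vars_def2)
  show "indep_sets (\<lambda>i. ?F (f i)) J"
  proof (rule indep_setsI)
    fix i assume "i \<in> J"
    then show "?F (f i) \<subseteq> events"
      using F by (simp add: indep_sets_def)
  next
    fix A K assume K: "K \<noteq> {}" "K \<subseteq> J" "finite K" and A: "\<forall>i\<in>K. A i \<in> ?F (f i)"
    have inj': "inj_on f K"
      using inj K(2) by (rule inj_on_subset)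
    let ?B = "\<lambda>i. A (the_inv_into K f i)"
    have inv: "the_inv_into K f (f i) = i" if "i \<in> K" for i
      using inj' that by (rule the_inv_into_f_f)
    have "\<forall>i\<in>f ` K. ?B i \<in> ?F i"
      using A inv by (auto simp del: mem_Collect_eq)
    then have "prob (\<Inter>i\<in>f ` K. ?B i) = (\<Prod>i\<in>f ` K. prob (?B i))"
      using F K by (intro indep_setsD[of ?F "f ` J"]) auto
    moreover have "(\<Inter>i\<in>f ` K. ?B i) = (\<Inter>i\<in>K. A i)"
      using inv by auto
    moreover have "(\<Prod>i\<in>f ` K. prob (?B i)) = (\<Prod>i\<in>K. prob (A i))"
      using inj' inv by (simp add: prod.reindex)
    ultimately show "prob (\<Inter>i\<in>K. A i) = (\<Prod>i\<in>K. prob (A i))"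
      by simp
  qed
qed

lemma (in correlated_ensemble) indep_representatives:
  assumes n: "n \<ge> 1" and J: "J \<subseteq> {1..n} \<times> {1..n}"
    and distinct: "\<And>x y. x \<in> J \<Longrightarrow> y \<in> J \<Longrightarrow> x \<noteq> y \<Longrightarrow> (x, y) \<notin> R n"
  shows "prob_space.indep_vars (M n) (\<lambda>_. borel) (a n) J"
proof -
  interpret prob_space "M n" using prob[OF n] .
  have eq: "equiv ({1..n} \<times> {1..n}) (R n)" using equiv_R[OF n] .
  let ?f = "\<lambda>x. R n `` {x}"
  have inj: "inj_on ?f J"
    using J distinct eq by (intro inj_onI) (meson eq_equiv_class subsetD)
  have sub: "?f ` J \<subseteq> ({1..n} \<times> {1..n}) // R n"
    using J by (auto intro: quotientI)
  have mem: "x \<in> ?f x" if "x \<in> J" for x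
    using that J equiv_class_self[OF eq] by blast
  have "indep_vars (\<lambda>c. \<Pi>\<^sub>M x\<in>c. borel) (\<lambda>c \<omega>. \<lambda>x\<in>c. a n x \<omega>) (?f ` J)"
    using indep_classes[OF n] sub by (rule indep_vars_subset)
  from indep_vars_reindex_inj[OF inj this]
  have "indep_vars (\<lambda>x. \<Pi>\<^sub>M y\<in>?f x. borel) (\<lambda>x \<omega>. \<lambda>y\<in>?f x. a n y \<omega>) J"
    by (simp add: o_def)
  then have "indep_vars (\<lambda>_. borel) (\<lambda>x \<omega>. (\<lambda>y\<in>?f x. a n y \<omega>) x) J"
    by (rule indep_vars_compose2[where Y = "\<lambda>x v. v x"])
       (auto intro!: measurable_component_singleton mem)
  moreover have "(\<lambda>\<omega>. (\<lambda>y\<in>?f x. a n y \<omega>) x) = a n x" if "x \<in> J" for x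
    using mem[OF that] by (auto simp: fun_eq_iff)
  ultimately show ?thesis
    using indep_vars_cong[of J J "\<lambda>x \<omega>. (\<lambda>y\<in>?f x. a n y \<omega>) x" "a n"] by blast
qed

definition alpha2 :: "nat \<Rightarrow> ((nat \<times> nat) \<times> (nat \<times> nat)) set \<Rightarrow> nat" where
  "alpha2 n r = (MAX x\<in>{1..n} \<times> {1..n}. card {y \<in> {1..n} \<times> {1..n}. (x, y) \<in> r})"

text \<open>Matrix indices start at 0.\<close>

definition ensemble_mat ::
  "(nat \<Rightarrow> nat \<times> nat \<Rightarrow> 'w \<Rightarrow> complex) \<Rightarrow> nat \<Rightarrow> 'w \<Rightarrow> complex mat" where
  "ensemble_mat a n \<omega> =
     complex_of_real (1 / sqrt (real n)) \<cdot>\<^sub>m Matrix.mat n n (\<lambda>(i, j). a n (i + 1, j + 1) \<omega>)"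

definition mat_trace :: "'b::comm_monoid_add mat \<Rightarrow> 'b" where
  "mat_trace A = (\<Sum>i<dim_row A. A $$ (i, i))"

definition joint_cumulant :: "'w measure \<Rightarrow> nat \<Rightarrow> (nat \<Rightarrow> 'w \<Rightarrow> complex) \<Rightarrow> complex" where
  "joint_cumulant N j Y =
     (\<Sum>P | partition_on {1..j} P.
        (- 1) ^ (card P - 1) * fact (card P - 1) * (\<Prod>B\<in>P. \<integral>\<omega>. (\<Prod>i\<in>B. Y i \<omega>) \<partial>N))"

end

theory Submission
  imports Defs "HOL-Real_Asymp.Real_Asymp"
begin

text \<open>
  The traces expand into sums over \<open>j\<close> closed paths with \<open>K = k\<^sub>1 + \<dots> + k\<^sub>j\<close> edges in total, and by
  multilinearity the cumulant is \<open>n\<^bsup>-K/2\<^esup>\<close> times a sum of joint cumulants of path products. Such a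
  cumulant vanishes if some equivalence class is visited by a single edge (the entries are
  centered) or if the circles split into two groups that share no class (by independence).
  It remains to bound the number of the other vertex configurations by
  \<open>O(n\<^bsup>(K-1)/2\<^esup> \<alpha>\<^sub>2\<^bsup>K\<^esup>)\<close>.

  For this, fix the partition of the edges into classes, and let a set of vertices be
  infected. If both ends of an edge are infected, so become the ends of all edges of its class:
  each new vertex then has at most \<open>\<alpha>\<^sub>2\<close> possible values. So it suffices to infect everything
  from fewer than \<open>K/2\<close> vertices. Start with one vertex; each further vertex, placed next to an
  infected one, infects a new class, so \<open>1 + #classes\<close> vertices suffice. A class \<open>B\<close> visited by
  only one edge \<open>e\<close> of some circle costs nothing: walk around this circle without crossing \<open>e\<close>,
  and \<open>B\<close> becomes infected for free. As \<open>K - 2 #classes\<close> is the sum of the excesses \<open>|B| - 2\<close>,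
  one needs total excess plus twice the number of free classes to be at least 3. Connectedness
  gives three circles linked in a chain by two classes. If all classes are pairs, both links are
  free; if some class is larger and some class is free, the excess is at least 1;
  if no class is free, the links alone have excess at least 4.
\<close>
section \<open>Infection on coloured circles\<close>

text \<open>A pair \<open>(i, l)\<close> stands both for vertex \<open>l\<close> of circle
  \<open>i\<close> and for the edge that leaves it; the other end of this edge is
  \<open>nxt k (i, l)\<close>.\<close>

definition nxt :: "('i \<Rightarrow> nat) \<Rightarrow> 'i \<times> nat \<Rightarrow> 'i \<times> nat" where
  "nxt k p = (fst p, Suc (snd p) mod k (fst p))"

text \<open>Sets closed under the infection rule, with \<open>r\<close> relating edges of the same
  class. The infection started from \<open>D\<close> thus ends in
  \<open>edge_closed k r hull D\<close>.\<close>

definition edge_closed :: "('i \<Rightarrow> nat) \<Rightarrow> (('i \<times> nat) \<times> ('i \<times> nat)) set \<Rightarrow> ('i \<times> nat) set \<Rightarrow> bool" where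
  "edge_closed k r W \<longleftrightarrow>
     (\<forall>q p. (q, p) \<in> r \<longrightarrow> q \<in> W \<longrightarrow> nxt k q \<in> W \<longrightarrow> p \<in> W \<and> nxt k p \<in> W)"

locale coloured_circles =
  fixes I :: "'i set" and k :: "'i \<Rightarrow> nat" and r :: "(('i \<times> nat) \<times> ('i \<times> nat)) set"
  assumes fin: "finite I" and k_pos: "i \<in> I \<Longrightarrow> k i \<ge> 1"
    and eqv: "equiv (Sigma I (\<lambda>i. {..<k i})) r"
begin

abbreviation positions :: "('i \<times> nat) set" where
  "positions \<equiv> Sigma I (\<lambda>i. {..<k i})"

abbreviation infected :: "('i \<times> nat) set \<Rightarrow> ('i \<times> nat) set" where
  "infected D \<equiv> edge_closed k r hull D"

text \<open>One edge inside \<open>H\<close> suffices: if \<open>H\<close> is closed, the rule puts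
  the ends of all other edges of the class into \<open>H\<close> too.\<close>

definition known :: "('i \<times> nat) set \<Rightarrow> ('i \<times> nat) set set" where
  "known H = {B \<in> positions // r. \<exists>p\<in>B. p \<in> H \<and> nxt k p \<in> H}"

lemma finite_positions: "finite positions"
  using fin by auto

lemma finite_classes: "finite (positions // r)"
  using finite_positions eqv by (meson equivE finite_quotient)

lemma finite_known: "finite (known H)"
  unfolding known_def using finite_classes by auto

lemma nxt_positions: "p \<in> positions \<Longrightarrow> nxt k p \<in> positions"
  using k_pos by (fastforce simp: nxt_def)

lemma r_positions: "(p, q) \<in> r \<Longrightarrow> p \<in> positions \<and> q \<in> positions"
  using eqv by (meson equiv_class_eq_iff)

lemma edge_closed_infected: "edge_closed k r (infected D)"
proof (rule hull_in)
  fix T assume T: "\<forall>W\<in>T. edge_closed k r W"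
  show "edge_closed k r (\<Inter>T)"
    unfolding edge_closed_def Inter_iff
  proof (intro allI impI conjI ballI)
    fix q p W assume "(q, p) \<in> r" "\<forall>W\<in>T. q \<in> W" "\<forall>W\<in>T. nxt k q \<in> W" "W \<in> T"
    then show "p \<in> W" "nxt k p \<in> W"
      using T unfolding edge_closed_def by blast+
  qed
qed

lemma infected_subset: "D \<subseteq> positions \<Longrightarrow> infected D \<subseteq> positions"
  by (rule hull_minimal) (use r_positions nxt_positions in \<open>auto simp: edge_closed_def\<close>)

lemma known_infected:
  assumes "B \<in> known (infected D)" "p \<in> B"
  shows "p \<in> infected D \<and> nxt k p \<in> infected D"
proof -
  obtain q where q: "q \<in> B" "q \<in> infected D" "nxt k q \<in> infected D" and B: "B \<in> positions // r"
    using assms(1) by (auto simp: known_def)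
  have "(q, p) \<in> r"
    using quotient_eq_iff[OF eqv B B q(1) assms(2)] by simp
  then show ?thesis
    using edge_closed_infected q unfolding edge_closed_def by blast
qed

lemma class_subset_positions: "B \<in> positions // r \<Longrightarrow> B \<subseteq> positions"
  using Union_quotient[OF eqv] by blast

text \<open>Greedy infection: while some edge with class outside \<open>A\<close> has exactly one
  infected end, infect the other end. Each added vertex makes a class outside \<open>A\<close> known
  that was not known before, so the number of added vertices is at most the number of newly known
  classes. The inequality is written with sums to avoid subtraction on \<open>nat\<close>.\<close>

lemma extend:
  assumes "D \<subseteq> positions"
  shows "\<exists>D'. D \<subseteq> D' \<and> D' \<subseteq> positions \<and>
    card (known (infected D) - A) + card D' \<le> card (known (infected D') - A) + card D \<and>
    (\<forall>p\<in>positions. r `` {p} \<notin> A \<longrightarrow> (p \<in> infected D' \<longleftrightarrow> nxt k p \<in> infected D'))"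
  using assms
proof (induction "card (positions - infected D)" arbitrary: D rule: less_induct)
  case less
  show ?case
  proof (cases "\<forall>p\<in>positions. r `` {p} \<notin> A \<longrightarrow> (p \<in> infected D \<longleftrightarrow> nxt k p \<in> infected D)")
    case True
    then show ?thesis using less.prems by blast
  next
    case False
    then obtain p where p: "p \<in> positions" "r `` {p} \<notin> A"
      "(p \<in> infected D) \<noteq> (nxt k p \<in> infected D)" by blast
    define x where "x = (if p \<in> infected D then nxt k p else p)"
    define E where "E = insert x D"
    have E: "E \<subseteq> positions"
      using less.prems p nxt_positions unfolding E_def x_def by auto
    have mono: "infected D \<subseteq> infected E"
      by (rule hull_mono) (auto simp: E_def)
    have xE: "x \<in> infected E"
      using hull_subset[of E "edge_closed k r"] by (auto simp: E_def)
    have pE: "p \<in> infected E" "nxt k p \<in> infected E"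
      using xE p(3) mono unfolding x_def by (auto split: if_splits)
    have x: "x \<notin> infected D" "x \<in> positions" using p nxt_positions by (auto simp: x_def)
    have pp: "p \<in> r `` {p}" using equiv_class_self[OF eqv p(1)] .
    \<comment> \<open>A known class has both ends of all its edges infected, so the class of
      \<open>p\<close> is new; it pays for the vertex \<open>x\<close>.\<close>
    have notin: "r `` {p} \<notin> known (infected D)"
      using known_infected pp p(3) by blast
    have "r `` {p} \<in> known (infected E)"
      unfolding known_def using pE p(1) pp by (auto intro: quotientI)
    moreover have "known (infected D) \<subseteq> known (infected E)"
      using mono unfolding known_def by blast
    ultimately have "insert (r `` {p}) (known (infected D) - A) \<subseteq> known (infected E) - A"
      using p(2) by blast
    then have "card (insert (r `` {p}) (known (infected D) - A)) \<le> card (known (infected E) - A)"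
      by (intro card_mono) (auto simp: finite_known)
    then have c1: "card (known (infected D) - A) + 1 \<le> card (known (infected E) - A)"
      using notin finite_known by simp
    have c2: "card E \<le> card D + 1"
      unfolding E_def by (metis Suc_eq_plus1 card_insert_if
          finite_positions finite_subset less.prems order_refl le_Suc_eq)
    have "card (positions - infected E) < card (positions - infected D)"
      by (rule psubset_card_mono) (use finite_positions mono x xE in auto)
    from less.hyps[OF this E] obtain D' where D': "E \<subseteq> D'" "D' \<subseteq> positions"
      "card (known (infected E) - A) + card D' \<le> card (known (infected D') - A) + card E"
      "\<forall>p\<in>positions. r `` {p} \<notin> A \<longrightarrow> (p \<in> infected D' \<longleftrightarrow> nxt k p \<in> infected D')" by blast
    have "D \<subseteq> D'" using D'(1) by (auto simp: E_def)
    then show ?thesis using D' c1 c2 by (intro exI[of _ D']) auto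
  qed
qed

text \<open>A circle without one edge is still a path through all its vertices, so membership in
  \<open>H\<close> spreads along it from \<open>v\<close>.\<close>

lemma circle_minus_edge:
  assumes H: "\<And>p. p \<in> positions \<Longrightarrow> fst p = i \<Longrightarrow> p \<noteq> e \<Longrightarrow> (p \<in> H \<longleftrightarrow> nxt k p \<in> H)"
    and e: "e \<in> positions" "fst e = i"
    and v: "v \<in> positions" "fst v = i" "v \<in> H"
    and q: "q \<in> positions" "fst q = i"
  shows "q \<in> H"
proof -
  define m where "m = k i"
  have i: "i \<in> I" using e by auto
  have m: "m \<ge> 1" using k_pos i by (simp add: m_def)
  obtain l where l: "e = (i, l)" "l < m" using e by (cases e) (auto simp: m_def)
  \<comment> \<open>The walk starts at the far end of \<open>e\<close> and reaches the vertex
    \<open>e\<close> itself at time \<open>m - 1\<close>; only the next step would cross the edge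
    \<open>e\<close>.\<close>
  define z where "z t = (i, (l + 1 + t) mod m)" for t
  have zP: "z t \<in> positions" for t using i m by (auto simp: z_def m_def)
  have z_nxt: "nxt k (z t) = z (Suc t)" for t
    by (simp add: z_def nxt_def m_def mod_Suc_eq)
  have const: "t < m \<Longrightarrow> (z t \<in> H) = (z 0 \<in> H)" for t
  proof (induction t)
    case (Suc t)
    have "(l + 1 + t) mod m \<noteq> l"
    proof
      assume "(l + 1 + t) mod m = l"
      then show False using Suc.prems l(2) by (cases "l + 1 + t < m") (auto simp: le_mod_geq)
    qed
    then have "z t \<noteq> e" by (simp add: z_def l)
    then have "(z t \<in> H) = (z (Suc t) \<in> H)" using H[OF zP[of t]] z_nxt by (simp add: z_def)
    then show ?case using Suc by simp
  qed simp
  have all: "\<exists>t<m. q = z t" if "q \<in> positions" "fst q = i" for q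
  proof -
    obtain y where y: "q = (i, y)" "y < m" using \<open>q \<in> positions\<close> \<open>fst q = i\<close> by (cases q) (auto simp: m_def)
    \<comment> \<open>This is \<open>y - (l + 1)\<close> modulo \<open>m\<close>, with
      \<open>m\<close> added so that the subtraction on \<open>nat\<close> does not
      truncate.\<close>
    define t where "t = (y + (m - (l + 1))) mod m"
    have "(l + 1 + t) mod m = (l + 1 + (y + (m - (l + 1)))) mod m"
      unfolding t_def by (rule mod_add_right_eq)
    also have "\<dots> = (y + m) mod m" using l(2) by (simp add: ac_simps)
    also have "\<dots> = y" using y by simp
    finally have "q = z t" using y by (simp add: z_def)
    moreover have "t < m" using m by (simp add: t_def)
    ultimately show ?thesis by blast
  qed
  show ?thesis using all[OF v(1,2)] all[OF q] const v(3) by metis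
qed

text \<open>\<open>A\<close> collects the free classes. Greedy infection from \<open>v\<close>,
  using only edges with class outside \<open>A\<close>, costs one vertex plus at most one per class
  outside \<open>A\<close>; by \<open>step\<close> the classes in \<open>A\<close> are then known
  without further cost. Hence no edge has exactly one infected end, infected circles are infected
  completely, and \<open>conn\<close> carries the infection to all circles.\<close>

lemma determining_set_aux:
  assumes conn: "\<And>J. J \<subset> I \<Longrightarrow> J \<noteq> {} \<Longrightarrow> \<exists>p q. (p, q) \<in> r \<and> fst p \<in> J \<and> fst q \<notin> J"
    and v: "v \<in> positions"
    and A: "A \<subseteq> positions // r"
    and step: "\<And>H. v \<in> H \<Longrightarrow> H \<subseteq> positions \<Longrightarrow> edge_closed k r H \<Longrightarrow>
       (\<And>p. p \<in> positions \<Longrightarrow> r `` {p} \<notin> A \<Longrightarrow> (p \<in> H \<longleftrightarrow> nxt k p \<in> H)) \<Longrightarrow> A \<subseteq> known H"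
  shows "\<exists>D\<subseteq>positions. card D + card A \<le> card (positions // r) + 1 \<and> infected D = positions"
proof -
  obtain D where D: "{v} \<subseteq> D" "D \<subseteq> positions"
    "card (known (infected {v}) - A) + card D \<le> card (known (infected D) - A) + card {v}"
    and both: "\<And>p. p \<in> positions \<Longrightarrow> r `` {p} \<notin> A \<Longrightarrow> (p \<in> infected D \<longleftrightarrow> nxt k p \<in> infected D)"
    using extend[of "{v}" A] v by blast
  define H where "H = infected D"
  have vH: "v \<in> H" using D(1) hull_subset[of D "edge_closed k r"] by (auto simp: H_def)
  have HP: "H \<subseteq> positions" using D(2) infected_subset by (simp add: H_def)
  have cl: "edge_closed k r H" using edge_closed_infected by (simp add: H_def)
  have AK: "A \<subseteq> known H" by (rule step[OF vH HP cl]) (use both in \<open>auto simp: H_def\<close>)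
  have both': "p \<in> H \<longleftrightarrow> nxt k p \<in> H" if "p \<in> positions" for p
  proof (cases "r `` {p} \<in> A")
    case True
    then show ?thesis using known_infected[of "r `` {p}" D p] AK equiv_class_self[OF eqv that]
      by (auto simp: H_def)
  next
    case False
    then show ?thesis using both[OF that] by (simp add: H_def)
  qed
  have circ: "q \<in> H" if "x \<in> H" "q \<in> positions" "fst q = fst x" for x q
    using circle_minus_edge[of "fst x" x H x q] both' that HP by auto
  \<comment> \<open>Otherwise \<open>conn\<close> links a completely infected circle to one without
    any infected vertex, contradicting closedness.\<close>
  have "H = positions"
  proof (rule ccontr)
    assume neq: "H \<noteq> positions"
    have "fst ` H \<subset> I"
    proof -
      obtain q where q: "q \<in> positions" "q \<notin> H" using neq HP by blast
      then have "fst q \<notin> fst ` H" using circ by auto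
      moreover have "fst q \<in> I" "fst ` H \<subseteq> I" using q HP by auto
      ultimately show ?thesis by blast
    qed
    from conn[OF this] obtain p q where pq: "(p, q) \<in> r" "fst p \<in> fst ` H" "fst q \<notin> fst ` H"
      using vH by blast
    have P: "p \<in> positions" "q \<in> positions" using r_positions pq by auto
    have "p \<in> H" using pq(2) circ P by auto
    then have "q \<in> H" using cl both'[OF P(1)] pq(1) unfolding edge_closed_def by blast
    then show False using pq(3) by blast
  qed
  moreover have "known (infected D) - A \<subseteq> positions // r - A" by (auto simp: known_def)
  then have "card (known (infected D) - A) \<le> card (positions // r - A)"
    by (intro card_mono) (auto simp: finite_classes)
  moreover have "card (positions // r - A) = card (positions // r) - card A"
    using A finite_classes by (simp add: card_Diff_subset finite_subset)
  moreover have "card A \<le> card (positions // r)" using A finite_classes by (simp add: card_mono)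
  ultimately show ?thesis using D by (intro exI[of _ D]) (auto simp: H_def)
qed

lemma card_positions: "card positions = (\<Sum>B\<in>positions // r. card B)"
proof -
  have "card (\<Union>(positions // r)) = (\<Sum>B\<in>positions // r. card B)"
  proof (rule card_Union_disjoint)
    show "pairwise disjnt (positions // r)"
      using quotient_disj[OF eqv] by (auto simp: pairwise_def disjnt_def)
    show "finite B" if "B \<in> positions // r" for B
      using class_subset_positions[OF that] finite_positions by (rule finite_subset)
  qed
  then show ?thesis using Union_quotient[OF eqv] by simp
qed

definition lone :: "('i \<times> nat) \<Rightarrow> bool" where
  "lone e \<longleftrightarrow> e \<in> positions \<and> (\<forall>q. (e, q) \<in> r \<longrightarrow> fst q = fst e \<longrightarrow> q = e)"

text \<open>No other edge of the circle of \<open>e\<close> belongs to the class of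
  \<open>e\<close>. If the remaining edges in exempted classes already lie inside \<open>H\<close>,
  the infection goes around the circle without crossing \<open>e\<close> and reaches both ends of
  \<open>e\<close>, so the class of \<open>e\<close> is known for free.\<close>

lemma lone_known:
  assumes e: "lone e" and A: "\<And>p. p \<in> positions \<Longrightarrow> fst p = fst e \<Longrightarrow> r `` {p} \<in> A \<Longrightarrow> p = e \<or> (p \<in> H \<and> nxt k p \<in> H)"
    and H: "\<And>p. p \<in> positions \<Longrightarrow> r `` {p} \<notin> A \<Longrightarrow> (p \<in> H \<longleftrightarrow> nxt k p \<in> H)"
    and v: "v \<in> positions" "fst v = fst e" "v \<in> H"
  shows "r `` {e} \<in> known H" "\<And>q. q \<in> positions \<Longrightarrow> fst q = fst e \<Longrightarrow> q \<in> H"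
proof -
  have eP: "e \<in> positions" using e by (simp add: lone_def)
  show *: "q \<in> H" if "q \<in> positions" "fst q = fst e" for q
    by (rule circle_minus_edge[of "fst e" e H v q]) (use A H v eP that in blast)+
  have "e \<in> H" "nxt k e \<in> H" using *[OF eP] *[OF nxt_positions[OF eP]] by (auto simp: nxt_def)
  then show "r `` {e} \<in> known H"
    unfolding known_def using eP equiv_class_self[OF eqv eP] by (auto intro: quotientI)
qed

theorem determining_set:
  assumes conn: "\<And>J. J \<subset> I \<Longrightarrow> J \<noteq> {} \<Longrightarrow> \<exists>p q. (p, q) \<in> r \<and> fst p \<in> J \<and> fst q \<notin> J"
    and three: "card I \<ge> 3" and two: "\<And>B. B \<in> positions // r \<Longrightarrow> card B \<ge> 2"
  shows "\<exists>D\<subseteq>positions. 2 * card D < card positions \<and> infected D = positions"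
proof -
  let ?P = "positions // r"
  \<comment> \<open>Classes outside \<open>T\<close> are counted with their minimal size 2, so only
    the excess of the classes in \<open>T\<close> is kept.\<close>
  have excess: "2 * card (?P - T) + (\<Sum>B\<in>T. card B) \<le> card positions" if "T \<subseteq> ?P" for T
  proof -
    have "2 * card (?P - T) = (\<Sum>B\<in>?P - T. 2)" by simp
    also have "\<dots> \<le> (\<Sum>B\<in>?P - T. card B)" by (rule sum_mono) (use two in auto)
    finally show ?thesis
      unfolding card_positions using sum.subset_diff[OF that finite_classes, of card] by linarith
  qed
  have card_diff: "card (?P - T) + card T = card ?P" if "T \<subseteq> ?P" for T
    using card_Diff_subset[OF finite_subset[OF that finite_classes] that] card_mono[OF finite_classes that]
    by linarith
  have pos2: "2 * card ?P \<le> card positions"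
    using excess[OF empty_subsetI] by (simp only: sum.empty Diff_empty add_0_right)
  have fin_class: "finite B" if "B \<in> ?P" for B
    using class_subset_positions[OF that] finite_positions by (rule finite_subset)
  \<comment> \<open>With \<open>card A\<close> free classes the determining set has at most
    \<open>card ?P + 1 - card A\<close> elements, which is less than half of
    \<open>card positions\<close> once the total excess plus \<open>2 * card A\<close> is at least
    3.\<close>
  have finish: ?thesis
    if ex: "\<exists>D\<subseteq>positions. card D + card A \<le> card ?P + 1 \<and> infected D = positions"
      and le: "2 * card ?P + 3 \<le> card positions + 2 * card A" for A
  proof -
    obtain D where D: "D \<subseteq> positions" "card D + card A \<le> card ?P + 1" "infected D = positions"
      using ex by blast
    have "2 * card D < card positions" using D(2) le by linarith
    then show ?thesis using D by blast
  qed
  have "I \<noteq> {}" using three by auto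
  then obtain u where u: "u \<in> I" by blast
  have "card {u} \<noteq> card I" using three by simp
  then have "{u} \<subset> I" using u by auto
  from conn[OF this] obtain p q where pq: "(p, q) \<in> r" "fst p = u" "fst q \<noteq> u" by auto
  have qI: "fst q \<in> I" using r_positions[OF pq(1)] by auto
  have "card {u, fst q} \<noteq> card I" using three by (simp add: card_insert_if)
  then have "{u, fst q} \<subset> I" using u qI by auto
  from conn[OF this] obtain x y where xy: "(x, y) \<in> r" "fst x \<in> {fst p, fst q}" "fst y \<notin> {fst p, fst q}"
    using pq(2) by auto
  have sym: "(q, p) \<in> r" "(y, x) \<in> r" using pq(1) xy(1) eqv by (meson equivE symE)+
  \<comment> \<open>The second link may leave either of the first two circles. After renaming, the
    circle of \<open>f\<close> and \<open>g\<close> is the middle of a chain of three distinct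
    circles.\<close>
  obtain e f g h where path: "(e, f) \<in> r" "(g, h) \<in> r" "fst f = fst g" "fst e \<noteq> fst f" "fst h \<noteq> fst g" "fst e \<noteq> fst h"
  proof (cases "fst x = fst q")
    case True
    then show ?thesis using that[of p q x y] pq xy by auto
  next
    case False
    then show ?thesis using that[of q p x y] pq xy sym by auto
  qed
  have P: "e \<in> positions" "f \<in> positions" "g \<in> positions" "h \<in> positions"
    using r_positions path by blast+
  have qI: "r `` {z} \<in> ?P" if "z \<in> positions" for z using that by (auto intro: quotientI)
  have self: "z \<in> r `` {z}" if "z \<in> positions" for z using equiv_class_self[OF eqv that] .
  have fe: "f \<in> r `` {e}" "h \<in> r `` {g}" using path by auto
  \<comment> \<open>The cases are exhaustive: if a lone edge exists and no class has three elements,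
    then all classes are pairs.\<close>
  consider "\<exists>z. lone z" "\<exists>B\<in>?P. card B \<ge> 3" | "\<forall>B\<in>?P. card B = 2" | "\<not> (\<exists>z. lone z)"
    using two by (metis Suc_leI le_neq_implies_less numeral_2_eq_2 numeral_3_eq_3)
  then show ?thesis
  proof cases
    case 1
    then obtain z B where z: "lone z" and B: "B \<in> ?P" "card B \<ge> 3" by blast
    have zP: "z \<in> positions" using z by (simp add: lone_def)
    have "\<exists>D\<subseteq>positions. card D + card {r `` {z}} \<le> card ?P + 1 \<and> infected D = positions"
    proof (rule determining_set_aux[OF conn zP])
      show "{r `` {z}} \<subseteq> ?P" using qI[OF zP] by simp
      fix H assume H: "z \<in> H" "H \<subseteq> positions" "edge_closed k r H"
        "\<And>p. p \<in> positions \<Longrightarrow> r `` {p} \<notin> {r `` {z}} \<Longrightarrow> (p \<in> H \<longleftrightarrow> nxt k p \<in> H)"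
      have "r `` {z} \<in> known H"
      proof (rule lone_known(1)[OF z _ H(4) zP refl H(1)])
        fix p assume "p \<in> positions" "fst p = fst z" "r `` {p} \<in> {r `` {z}}"
        then show "p = z \<or> p \<in> H \<and> nxt k p \<in> H" using z self[of p] by (auto simp: lone_def)
      qed auto
      then show "{r `` {z}} \<subseteq> known H" by simp
    qed
    \<comment> \<open>The class \<open>B\<close> gives excess at least 1 and the free class counts
      2, which makes 3.\<close>
    moreover have "2 * card ?P < card positions"
      using excess[of "{B}"] card_diff[of "{B}"] B by simp
    ultimately show ?thesis by (intro finish[of "{r `` {z}}"]) simp_all
  next
    case 2
    have pair: "z = a \<or> z = b" if "(a, b) \<in> r" "(a, z) \<in> r" "a \<noteq> b" for a b z
    proof -
      have aP: "a \<in> positions" using r_positions that by blast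
      have "card (r `` {a}) = 2" using 2 qI[OF aP] by blast
      moreover have "{a, b} \<subseteq> r `` {a}" using that self[OF aP] by auto
      ultimately have "{a, b} = r `` {a}"
        using fin_class[OF qI[OF aP]] that(3) by (intro card_subset_eq) auto
      then show ?thesis using that by blast
    qed
    \<comment> \<open>The only other edge in the class of \<open>e\<close> is \<open>f\<close>,
      which lies on another circle; likewise \<open>h\<close> for \<open>g\<close>.\<close>
    have le: "lone e" using pair[OF path(1)] path P unfolding lone_def by metis
    have lg: "lone g" using pair[OF path(2)] path P unfolding lone_def by metis
    have neq: "r `` {e} \<noteq> r `` {g}"
    proof
      assume "r `` {e} = r `` {g}"
      then have "h \<in> r `` {e}" using fe by simp
      then show False using pair[OF path(1), of h] path by auto
    qed
    define A where "A = {r `` {e}, r `` {g}}"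
    have "\<exists>D\<subseteq>positions. card D + card A \<le> card ?P + 1 \<and> infected D = positions"
    proof (rule determining_set_aux[OF conn P(1)])
      show "A \<subseteq> ?P" using qI P by (simp add: A_def)
      fix H assume H: "e \<in> H" "H \<subseteq> positions" "edge_closed k r H"
        "\<And>p. p \<in> positions \<Longrightarrow> r `` {p} \<notin> A \<Longrightarrow> (p \<in> H \<longleftrightarrow> nxt k p \<in> H)"
      \<comment> \<open>The circle of \<open>e\<close> comes first: \<open>g\<close> and
        \<open>h\<close> lie on the two other circles, so \<open>e\<close> is its only edge with
        class in \<open>A\<close>.\<close>
      have E: "q \<in> H" if "q \<in> positions" "fst q = fst e" for q
      proof (rule lone_known(2)[OF le _ H(4) P(1) refl H(1) that])
        fix p assume p: "p \<in> positions" "fst p = fst e" "r `` {p} \<in> A"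
        then consider "p \<in> r `` {e}" | "p \<in> r `` {g}" using self[of p] by (auto simp: A_def)
        then show "p = e \<or> p \<in> H \<and> nxt k p \<in> H"
        proof cases
          case 1
          then show ?thesis using le p by (auto simp: lone_def)
        next
          case 2
          then have "p = g \<or> p = h" using pair[OF path(2), of p] path by auto
          then show ?thesis using p(2) path by metis
        qed
      qed auto
      have eH: "e \<in> H" "nxt k e \<in> H" using E[OF P(1)] E[OF nxt_positions[OF P(1)]] by (auto simp: nxt_def)
      have Be: "p \<in> H \<and> nxt k p \<in> H" if "(e, p) \<in> r" for p
        using H(3) eH that unfolding edge_closed_def by blast
      have K1: "r `` {e} \<in> known H" unfolding known_def using eH qI[OF P(1)] self[OF P(1)] by blast
      \<comment> \<open>Now the middle circle: both ends of \<open>f\<close> are infected because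
        the class of \<open>e\<close> is known. This gives a starting vertex there and leaves
        \<open>g\<close> as the only edge to go around.\<close>
      have "r `` {g} \<in> known H"
      proof (rule lone_known(1)[OF lg _ H(4) P(2)])
        fix p assume p: "p \<in> positions" "fst p = fst g" "r `` {p} \<in> A"
        then consider "p \<in> r `` {e}" | "p \<in> r `` {g}" using self[of p] by (auto simp: A_def)
        then show "p = g \<or> p \<in> H \<and> nxt k p \<in> H"
        proof cases
          case 1
          then show ?thesis using Be by auto
        next
          case 2
          then show ?thesis using lg p by (auto simp: lone_def)
        qed
      qed (use path Be in auto)
      then show "A \<subseteq> known H" using K1 by (simp add: A_def)
    qed
    \<comment> \<open>Two free classes count 4, which suffices even without any excess.\<close>
    moreover have "card A = 2" using neq by (simp add: A_def)
    ultimately show ?thesis using pos2 by (intro finish[of A]) simp_all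
  next
    case 3
    have other: "\<exists>b. b \<noteq> a \<and> (a, b) \<in> r \<and> fst b = fst a" if "a \<in> positions" for a
      using 3 that unfolding lone_def by metis
    have trans: "(a, c) \<in> r" if "(a, b) \<in> r" "(b, c) \<in> r" for a b c
      using eqv that by (meson equivE transE)
    obtain e' f' g' h' where o: "e' \<noteq> e" "(e, e') \<in> r" "fst e' = fst e" "f' \<noteq> f" "(f, f') \<in> r" "fst f' = fst f"
      "g' \<noteq> g" "(g, g') \<in> r" "fst g' = fst g" "h' \<noteq> h" "(h, h') \<in> r" "fst h' = fst h"
      using other P by metis
    have four: "card B \<ge> 4" if "B \<in> ?P" "{a, a', b, b'} \<subseteq> B" "a \<noteq> a'" "b \<noteq> b'" "fst a = fst a'" "fst b = fst b'"
      "fst a \<noteq> fst b" for B a a' b b'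
    proof -
      have "distinct [a, a', b, b']" using that by auto
      from distinct_card[OF this] have "card {a, a', b, b'} = 4" by simp
      then show ?thesis using card_mono[OF fin_class[OF that(1)] that(2)] by simp
    qed
    have s1: "{e, e', f, f'} \<subseteq> r `` {e}" using o path self[OF P(1)] trans by blast
    have s2: "{g, g', h, h'} \<subseteq> r `` {g}" using o path self[OF P(3)] trans by blast
    have "2 * card ?P + 4 \<le> card positions"
    \<comment> \<open>Without lone edges, a class has at least two edges on every circle it visits.
      A class carrying both links visits three circles and has at least 6 edges; two distinct link
      classes have at least 4 each. Either way the excess is at least 4, and no free class is
      required.\<close>
    proof (cases "r `` {e} = r `` {g}")
      case True
      then have "{e, e', f, f', h, h'} \<subseteq> r `` {e}" using s1 s2 by blast
      moreover have "distinct [e, e', f, f', h, h']" using o path by auto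
      from distinct_card[OF this] have "card {e, e', f, f', h, h'} = 6" by simp
      ultimately have "card (r `` {e}) \<ge> 6" using card_mono[OF fin_class[OF qI[OF P(1)]]] by metis
      then show ?thesis using excess[of "{r `` {e}}"] card_diff[of "{r `` {e}}"] qI P by simp
    next
      case False
      have "card (r `` {e}) \<ge> 4" "card (r `` {g}) \<ge> 4"
        using four[OF qI[OF P(1)] s1] four[OF qI[OF P(3)] s2] o path by auto
      then show ?thesis using excess[of "{r `` {e}, r `` {g}}"] card_diff[of "{r `` {e}, r `` {g}}"] qI P False by simp
    qed
    moreover have "\<exists>D\<subseteq>positions. card D + card ({} :: ('i \<times> nat) set set) \<le> card ?P + 1 \<and> infected D = positions"
      by (rule determining_set_aux[OF conn P(1)]) auto
    ultimately show ?thesis by (intro finish[of "{}"]) simp_all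
  qed
qed

end

section \<open>Counting configurations\<close>

text \<open>The labels \<open>u\<close> take values in \<open>{..<n}\<close>, whereas the entries
  are indexed from 1.\<close>

definition edge :: "('i \<Rightarrow> nat) \<Rightarrow> ('i \<times> nat \<Rightarrow> nat) \<Rightarrow> 'i \<times> nat \<Rightarrow> nat \<times> nat" where
  "edge k u p = (Suc (u p), Suc (u (nxt k p)))"

text \<open>Follow the infection backwards from knowledge: the values on \<open>D\<close> are chosen
  freely, in at most \<open>n ^ card D\<close> ways. As long as the set \<open>W\<close> of treated
  positions is not everything, it is not closed, so an edge inside \<open>W\<close> determines the
  matrix class of an edge leaving \<open>W\<close>; a new vertex of that edge has at most \<alpha>
  possible values.\<close>

lemma card_configurations_le:
  fixes S :: "('i \<times> nat \<Rightarrow> nat) set"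
  assumes P: "finite P" and S: "S \<subseteq> PiE P (\<lambda>_. {..<n})" and r: "r \<subseteq> P \<times> P"
    and nxt: "\<And>p. p \<in> P \<Longrightarrow> nxt k p \<in> P"
    and D: "D \<subseteq> P" "edge_closed k r hull D = P"
    and compat: "\<And>u q p. u \<in> S \<Longrightarrow> (q, p) \<in> r \<Longrightarrow> (edge k u q, edge k u p) \<in> R"
    and class_bound: "\<And>x. x \<in> {1..n} \<times> {1..n} \<Longrightarrow> finite (R `` {x}) \<and> card (R `` {x}) \<le> \<alpha>"
    and "\<alpha> \<ge> 1"
  shows "card S \<le> n ^ card D * \<alpha> ^ card P"
proof -
  let ?N = "\<lambda>W. card ((\<lambda>u. restrict u W) ` S)"
  have finS: "finite S" using S P by (auto intro: finite_subset finite_PiE)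
  have main: "card S \<le> ?N W * \<alpha> ^ card (P - W)" if "D \<subseteq> W" "W \<subseteq> P" for W
    using that
  proof (induction "card (P - W)" arbitrary: W rule: less_induct)
    case less
    show ?case
    proof (cases "W = P")
      case True
      have "(\<lambda>u. restrict u W) ` S = id ` S"
        using S unfolding True by (intro image_cong refl) (auto simp: PiE_restrict)
      then show ?thesis using True by simp
    next
      case False
      have "\<not> edge_closed k r W"
        using hull_minimal[of D W "edge_closed k r"] D(2) less.prems False by auto
      then obtain q p where qp: "(q, p) \<in> r" "q \<in> W" "nxt k q \<in> W" "p \<notin> W \<or> nxt k p \<notin> W"
        by (auto simp: edge_closed_def)
      have "(q, p) \<in> P \<times> P" using qp(1) r by (rule rev_subsetD)
      then have P': "q \<in> P" "p \<in> P" "nxt k p \<in> P" using nxt[of p] by simp_all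
      \<comment> \<open>\<open>x\<close> is an end of \<open>p\<close> outside \<open>W\<close>, and
        \<open>pr\<close> reads the coordinate of the matrix position in which its label
        occurs.\<close>
      obtain x pr where x: "x \<in> P" "x \<notin> W" "\<And>u. pr (edge k u p) = Suc (u x)"
      proof (cases "p \<in> W")
        case True
        then show ?thesis using that[of "nxt k p" snd] P' qp by (simp add: edge_def)
      next
        case False
        then show ?thesis using that[of p fst] P' by (simp add: edge_def)
      qed
      \<comment> \<open>The candidates for extending \<open>t\<close> to \<open>x\<close>: one for
        each member of the class of the known edge. Subtracting 1 undoes the index shift in
        \<open>edge\<close>.\<close>
      let ?G = "\<lambda>t. (\<lambda>y. t(x := pr y - 1)) ` (R `` {edge k t q})"
      have sub: "(\<lambda>u. restrict u (insert x W)) ` S \<subseteq> (\<Union>t\<in>(\<lambda>u. restrict u W) ` S. ?G t)"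
      proof
        fix t assume "t \<in> (\<lambda>u. restrict u (insert x W)) ` S"
        then obtain u where u: "u \<in> S" "t = restrict u (insert x W)" by blast
        have "edge k (restrict u W) q = edge k u q" using qp by (simp add: edge_def)
        then have e: "edge k u p \<in> R `` {edge k (restrict u W) q}" using compat[OF u(1) qp(1)] by simp
        have "t = (restrict u W)(x := pr (edge k u p) - 1)"
          unfolding x(3) u(2) using x(2) by (auto simp: fun_eq_iff)
        then show "t \<in> (\<Union>t\<in>(\<lambda>u. restrict u W) ` S. ?G t)" using e u(1) by blast
      qed
      have G: "finite (?G t) \<and> card (?G t) \<le> \<alpha>" if t: "t \<in> (\<lambda>u. restrict u W) ` S" for t
      proof -
        obtain u where u: "u \<in> S" "t = restrict u W" using t by blast
        have "u q < n" "u (nxt k q) < n" using S u(1) P'(1) nxt[OF P'(1)] by (auto simp: PiE_iff)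
        then have "edge k t q \<in> {1..n} \<times> {1..n}" using qp u(2) by (auto simp: edge_def)
        from class_bound[OF this] show ?thesis using card_image_le le_trans by blast
      qed
      have "?N (insert x W) \<le> card (\<Union>t\<in>(\<lambda>u. restrict u W) ` S. ?G t)"
        by (rule card_mono[OF _ sub]) (use finS G in auto)
      also have "\<dots> \<le> (\<Sum>t\<in>(\<lambda>u. restrict u W) ` S. card (?G t))"
        by (rule card_UN_le) (use finS in auto)
      also have "\<dots> \<le> (\<Sum>t\<in>(\<lambda>u. restrict u W) ` S. \<alpha>)"
        by (rule sum_mono) (use G in auto)
      finally have N: "?N (insert x W) \<le> ?N W * \<alpha>" by simp
      have card: "card (P - W) = Suc (card (P - insert x W))"
        using x(1,2) P by (metis Diff_iff Diff_insert card_Suc_Diff1 finite_Diff)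
      have "card S \<le> ?N (insert x W) * \<alpha> ^ card (P - insert x W)"
        by (rule less.hyps) (use card x less.prems in auto)
      also have "\<dots> \<le> ?N W * \<alpha> * \<alpha> ^ card (P - insert x W)" using N by simp
      finally show ?thesis by (simp add: card mult.assoc)
    qed
  qed
  have fP: "finite (PiE D (\<lambda>_. {..<n}))" using finite_subset[OF D(1) P] by (intro finite_PiE) auto
  have "?N D \<le> card (PiE D (\<lambda>_. {..<n}))"
    by (rule card_mono[OF fP]) (use S D(1) in \<open>auto simp: PiE_iff subset_iff\<close>)
  also have "\<dots> = n ^ card D" using finite_subset[OF D(1) P] by (simp add: card_PiE)
  finally have "?N D \<le> n ^ card D" .
  moreover have "\<alpha> ^ card (P - D) \<le> \<alpha> ^ card P"
    using P \<open>\<alpha> \<ge> 1\<close> by (intro power_increasing card_mono) auto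
  ultimately have "?N D * \<alpha> ^ card (P - D) \<le> n ^ card D * \<alpha> ^ card P" by (rule mult_le_mono)
  then show ?thesis using main[OF order_refl D(1)] by linarith
qed

section \<open>Joint cumulants\<close>

text \<open>The cumulant formula for an arbitrary set function, with \<open>f B\<close> in the role
  of the mixed moment of the variables indexed by \<open>B\<close>. This separates the combinatorics
  from integration.\<close>

definition cumulant :: "('a set \<Rightarrow> 'b::{comm_ring_1, semiring_char_0}) \<Rightarrow> 'a set \<Rightarrow> 'b" where
  "cumulant f S = (\<Sum>P | partition_on S P. (- 1) ^ (card P - 1) * fact (card P - 1) * (\<Prod>B\<in>P. f B))"

lemma finite_partitions: "finite S \<Longrightarrow> finite {P. partition_on S P}"
  by (rule finite_subset[of _ "Pow (Pow S)"]) (auto simp: partition_on_def)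

lemma finite_partition: "finite S \<Longrightarrow> partition_on S P \<Longrightarrow> finite P"
  by (rule finite_subset[of _ "Pow S"]) (auto simp: partition_on_def)

text \<open>The moment-cumulant formula with the block \<open>B\<close> of \<open>x\<close> singled
  out. For \<open>B\<close> other than \<open>S\<close>, expand \<open>cumulant f B\<close> and add
  \<open>S - B\<close> as a marked block. A partition of \<open>S\<close> with \<open>m\<close>
  blocks then arises \<open>m - 1\<close> times, once for each block that misses \<open>x\<close>,
  and for \<open>m\<close> at least 2 the coefficients combine to minus the one in
  \<open>cumulant f S\<close>.\<close>

lemma cumulant_recursion:
  fixes f :: "'a set \<Rightarrow> 'b::{comm_ring_1, semiring_char_0}"
  assumes S: "finite S" and x: "x \<in> S" and f0: "f {} = 1"
  shows "(\<Sum>B | x \<in> B \<and> B \<subseteq> S. cumulant f B * f (S - B)) = f S"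
proof -
  define c :: "nat \<Rightarrow> 'b" where "c m = (- 1) ^ (m - 1) * fact (m - 1)" for m
  define W where "W P = (\<Prod>B\<in>P. f B)" for P
  define Bs where "Bs = {B. x \<in> B \<and> B \<subset> S}"
  define Q where "Q = {P. partition_on S P}"
  have finBs: "finite Bs" unfolding Bs_def by (rule finite_subset[of _ "Pow S"]) (use S in auto)
  have finQ: "finite Q" using finite_partitions[OF S] by (simp add: Q_def)
  have split: "{B. x \<in> B \<and> B \<subseteq> S} = insert S Bs" using x by (auto simp: Bs_def)
  have "(\<Sum>B\<in>Bs. cumulant f B * f (S - B))
      = (\<Sum>B\<in>Bs. \<Sum>P | partition_on B P. c (card P) * W P * f (S - B))"
    by (simp add: cumulant_def c_def W_def sum_distrib_right)
  also have "\<dots> = (\<Sum>(B, P)\<in>Sigma Bs (\<lambda>B. {P. partition_on B P}). c (card P) * W P * f (S - B))"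
    by (rule sum.Sigma) (use finBs in \<open>auto simp: Bs_def intro!: finite_partitions finite_subset[OF _ S]\<close>)
  \<comment> \<open>\<open>C\<close> is the added block \<open>S - B\<close>; the coefficient is
    still the one for the old number of blocks.\<close>
  also have "\<dots> = (\<Sum>(P, C)\<in>Sigma Q (\<lambda>P. {C\<in>P. x \<notin> C}). c (card P - 1) * W P)"
  proof (rule sum.reindex_bij_witness[of _ "\<lambda>(P, C). (S - C, P - {C})" "\<lambda>(B, P). (insert (S - B) P, S - B)"], goal_cases)
    case (1 z)
    then obtain B P where z: "z = (B, P)" "x \<in> B" "B \<subset> S" "partition_on B P" by (auto simp: Bs_def)
    have "S - B \<notin> P" using z partition_onD1[OF z(4)] by auto
    then show ?case using z by auto
  next
    case (2 z)
    then obtain B P where z: "z = (B, P)" "x \<in> B" "B \<subset> S" "partition_on B P" by (auto simp: Bs_def)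
    have "partition_on S (insert (S - B) P)"
      using partition_on_insert[of "S - B" P S] z by (auto simp: partition_on_def disjnt_def)
    then show ?case using z by (auto simp: Q_def)
  next
    case (3 z)
    then obtain P C where z: "z = (P, C)" "partition_on S P" "C \<in> P" "x \<notin> C" by (auto simp: Q_def)
    then have "S - (S - C) = C" by (auto simp: partition_on_def)
    then show ?case using z by (simp add: insert_absorb)
  next
    case (4 z)
    then obtain P C where z: "z = (P, C)" "partition_on S P" "C \<in> P" "x \<notin> C" by (auto simp: Q_def)
    have C: "C \<subseteq> S" "C \<noteq> {}" using z by (auto simp: partition_on_def)
    have "\<Union>(P - {C}) = S - C"
      using z(2,3) by (fastforce simp: partition_on_def disjoint_def)
    then have "partition_on (S - C) (P - {C})"
      using z(2) by (auto simp: partition_on_def disjoint_def)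
    then show ?case using z C x by (auto simp: Bs_def)
  next
    case (5 z)
    then obtain B P where z: "z = (B, P)" "x \<in> B" "B \<subset> S" "partition_on B P" by (auto simp: Bs_def)
    have "S - B \<notin> P" using z partition_onD1[OF z(4)] by auto
    moreover have "finite P" using finite_partition[OF _ z(4)] z(3) S finite_subset by blast
    ultimately show ?case using z by (simp add: W_def mult.commute mult.left_commute)
  qed
  also have "\<dots> = (\<Sum>P\<in>Q. \<Sum>C | C \<in> P \<and> x \<notin> C. c (card P - 1) * W P)"
    by (rule sum.Sigma[symmetric]) (use finQ finite_partition[OF S] in \<open>auto simp: Q_def\<close>)
  also have "\<dots> = (\<Sum>P\<in>Q. (if P = {S} then f S else 0) - c (card P) * W P)"
  proof (rule sum.cong[OF refl])
    fix P assume "P \<in> Q"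
    then have P: "partition_on S P" by (simp add: Q_def)
    have finP: "finite P" using finite_partition[OF S P] .
    obtain B where B: "B \<in> P" "x \<in> B" using P x by (auto simp: partition_on_def)
    have "{C. C \<in> P \<and> x \<notin> C} = P - {B}"
      using P B by (auto simp: partition_on_def disjoint_def)
    then have card: "card {C. C \<in> P \<and> x \<notin> C} = card P - 1" using B finP by simp
    show "(\<Sum>C | C \<in> P \<and> x \<notin> C. c (card P - 1) * W P) = (if P = {S} then f S else 0) - c (card P) * W P"
    proof (cases "P = {S}")
      case True
      then have no: "{C. C \<in> P \<and> x \<notin> C} = {}" using x by auto
      show ?thesis unfolding no using True by (simp add: c_def W_def)
    next
      case False
      have "P - {B} \<noteq> {}"
      proof
        assume "P - {B} = {}"
        then have "P = {B}" using B by auto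
        then show False using False P by (auto simp: partition_on_def)
      qed
      then have "card (P - {B}) \<noteq> 0" using finP by simp
      then have "card P \<ge> 2" using B finP by simp
      then obtain m where m: "card P = Suc (Suc m)" by (metis add_2_eq_Suc le_Suc_ex)
      \<comment> \<open>The factorial absorbs the number of marked blocks, and the extra block
        changes the sign.\<close>
      have "of_nat (card P - 1) * c (card P - 1) = - c (card P)"
        by (simp add: m c_def algebra_simps)
      then show ?thesis using False by (simp add: card flip: mult.assoc)
    qed
  qed
  also have "\<dots> = f S - cumulant f S"
  proof -
    have "{S} \<in> Q" using x by (auto simp: Q_def partition_on_def)
    then show ?thesis
      by (simp add: sum_subtractf finQ) (simp add: cumulant_def c_def W_def Q_def)
  qed
  finally have "(\<Sum>B\<in>Bs. cumulant f B * f (S - B)) = f S - cumulant f S" .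
  then show ?thesis
    unfolding split using finBs by (simp add: Bs_def f0)
qed

text \<open>Induction over the recursion at \<open>x\<close>: a proper subset \<open>B\<close>
  containing \<open>x\<close> and reaching outside \<open>J\<close> has vanishing cumulant. The sets
  inside \<open>S \<inter> J\<close> contribute, by the recursion for \<open>S \<inter> J\<close>,
  exactly \<open>f (S \<inter> J) * f (S - J) = f S\<close>, so nothing is left for
  \<open>cumulant f S\<close>.\<close>

lemma cumulant_split:
  fixes f :: "'a set \<Rightarrow> 'b::{comm_ring_1, semiring_char_0}"
  assumes "finite S" and f0: "f {} = 1"
    and mult: "\<And>B. B \<subseteq> S \<Longrightarrow> f B = f (B \<inter> J) * f (B - J)"
    and "x \<in> S" "x \<in> J" "y \<in> S" "y \<notin> J"
  shows "cumulant f S = 0"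
  using assms(1) mult assms(4-)
proof (induction S arbitrary: y rule: finite_psubset_induct)
  case (psubset S)
  have fin: "finite {B. x \<in> B \<and> B \<subseteq> T}" if "T \<subseteq> S" for T
    by (rule finite_subset[of _ "Pow S"]) (use that psubset in auto)
  let ?g = "\<lambda>B. cumulant f B * f (S - B)"
  have SJ: "S \<inter> J \<noteq> S" using psubset.prems by auto
  have "f S = (\<Sum>B | x \<in> B \<and> B \<subseteq> S. ?g B)"
    using cumulant_recursion[OF psubset.hyps(1) psubset.prems(2), of f] f0 by simp
  also have "\<dots> = (\<Sum>B\<in>insert S {B. x \<in> B \<and> B \<subseteq> S \<inter> J}. ?g B)"
  proof (rule sum.mono_neutral_right)
    show "finite {B. x \<in> B \<and> B \<subseteq> S}" by (rule fin) simp
    show "\<forall>B\<in>{B. x \<in> B \<and> B \<subseteq> S} - insert S {B. x \<in> B \<and> B \<subseteq> S \<inter> J}. ?g B = 0"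
    proof
      fix B assume B: "B \<in> {B. x \<in> B \<and> B \<subseteq> S} - insert S {B. x \<in> B \<and> B \<subseteq> S \<inter> J}"
      then obtain z where z: "z \<in> B" "z \<notin> J" by auto
      have "cumulant f B = 0"
        by (rule psubset.IH[of B z]) (use B z psubset.prems in auto)
      then show "?g B = 0" by simp
    qed
  qed (use psubset.prems in auto)
  also have "\<dots> = cumulant f S + (\<Sum>B | x \<in> B \<and> B \<subseteq> S \<inter> J. ?g B)"
    using SJ fin[of "S \<inter> J"] f0 by (subst sum.insert) auto
  also have "(\<Sum>B | x \<in> B \<and> B \<subseteq> S \<inter> J. ?g B)
      = (\<Sum>B | x \<in> B \<and> B \<subseteq> S \<inter> J. cumulant f B * f (S \<inter> J - B)) * f (S - J)"
    unfolding sum_distrib_right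
  proof (rule sum.cong[OF refl])
    fix B assume B: "B \<in> {B. x \<in> B \<and> B \<subseteq> S \<inter> J}"
    have "(S - B) \<inter> J = S \<inter> J - B" "S - B - J = S - J" using B by auto
    then show "?g B = cumulant f B * f (S \<inter> J - B) * f (S - J)"
      using psubset.prems(1)[of "S - B"] by (simp add: mult.assoc)
  qed
  also have "(\<Sum>B | x \<in> B \<and> B \<subseteq> S \<inter> J. cumulant f B * f (S \<inter> J - B)) = f (S \<inter> J)"
    using psubset.hyps(1) psubset.prems(2,3) by (intro cumulant_recursion f0) auto
  also have "f (S \<inter> J) * f (S - J) = f S" using psubset.prems(1)[of S] by simp
  finally show ?case by simp
qed

text \<open>Distributivity: a choice of one family on each block glues to a single family on
  \<open>S\<close>, and \<open>F B\<close> sees only its part on \<open>B\<close>.\<close>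

lemma prod_partition_sum_PiE:
  fixes F :: "'a set \<Rightarrow> ('a \<Rightarrow> 'c) \<Rightarrow> 'b::comm_semiring_1"
  assumes S: "finite S" and P: "partition_on S P" and V: "\<And>i. i \<in> S \<Longrightarrow> finite (V i)"
    and F: "\<And>B w. B \<in> P \<Longrightarrow> F B (restrict w B) = F B w"
  shows "(\<Prod>B\<in>P. \<Sum>w\<in>PiE B V. F B w) = (\<Sum>w\<in>PiE S V. \<Prod>B\<in>P. F B w)"
proof -
  have finP: "finite P" using finite_partition[OF S P] .
  have BS: "B \<subseteq> S" if "B \<in> P" for B using P that by (auto simp: partition_on_def)
  have uniq: "B = C" if "B \<in> P" "C \<in> P" "i \<in> B" "i \<in> C" for B C i
    using P that by (auto simp: partition_on_def disjoint_def)
  define bl where "bl i = (THE B. B \<in> P \<and> i \<in> B)" for i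
  have bl: "bl i = B" if "B \<in> P" "i \<in> B" for i B
    unfolding bl_def by (rule the_equality) (use that uniq in \<open>blast+\<close>)
  have bl': "bl i \<in> P \<and> i \<in> bl i" if "i \<in> S" for i
  proof -
    obtain B where "B \<in> P" "i \<in> B" using P \<open>i \<in> S\<close> by (auto simp: partition_on_def)
    then show ?thesis using bl by auto
  qed
  have "(\<Prod>B\<in>P. \<Sum>w\<in>PiE B V. F B w) = (\<Sum>g\<in>PiE P (\<lambda>B. PiE B V). \<Prod>B\<in>P. F B (g B))"
    by (rule prod_sum_PiE) (use finP BS V S in \<open>auto intro!: finite_PiE intro: finite_subset\<close>)
  also have "\<dots> = (\<Sum>w\<in>PiE S V. \<Prod>B\<in>P. F B w)"
  proof (rule sum.reindex_bij_witness[of _ "\<lambda>w. \<lambda>B\<in>P. restrict w B" "\<lambda>g. \<lambda>i\<in>S. g (bl i) i"], goal_cases)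
    case (1 g)
    show ?case
    proof
      fix B
      show "(\<lambda>B\<in>P. restrict (\<lambda>i\<in>S. g (bl i) i) B) B = g B"
      proof (cases "B \<in> P")
        case True
        then have "g B \<in> PiE B V" using 1 by auto
        then have "g B = restrict (g B) B" by (simp add: PiE_restrict)
        moreover have "restrict (\<lambda>i\<in>S. g (bl i) i) B = restrict (g B) B"
          using True bl BS by (intro restrict_ext) auto
        ultimately show ?thesis using True by simp
      next
        case False
        then show ?thesis using 1 by (auto simp: PiE_def extensional_def)
      qed
    qed
  next
    case (2 g)
    then show ?case using bl' by (auto simp: PiE_iff)
  next
    case (3 w)
    show ?case
    proof
      fix i
      show "(\<lambda>i\<in>S. (\<lambda>B\<in>P. restrict w B) (bl i) i) i = w i"
        using 3 bl' by (cases "i \<in> S") (auto simp: PiE_def extensional_def)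
    qed
  next
    case (4 w)
    then show ?case using BS by (auto simp: PiE_iff extensional_def)
  next
    case (5 g)
    show ?case
    proof (rule prod.cong[OF refl])
      fix B assume B: "B \<in> P"
      have "g B \<in> PiE B V" using 5 B by auto
      then have "g B = restrict (g B) B" by (simp add: PiE_restrict)
      also have "\<dots> = restrict (\<lambda>i\<in>S. g (bl i) i) B"
        using B bl BS[OF B] by (intro restrict_ext) auto
      finally show "F B (\<lambda>i\<in>S. g (bl i) i) = F B (g B)" using F[OF B] by metis
    qed
  qed
  finally show ?thesis .
qed

text \<open>Multilinearity of cumulants: variable \<open>i\<close> is \<open>c i\<close> times a sum
  indexed by \<open>V i\<close>, and \<open>f w\<close> gives the mixed moments of the summands
  selected by \<open>w\<close>.\<close>

lemma cumulant_sum: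
  fixes f :: "('a \<Rightarrow> 'c) \<Rightarrow> 'a set \<Rightarrow> 'b::{comm_ring_1, semiring_char_0}"
  assumes S: "finite S" and V: "\<And>i. i \<in> S \<Longrightarrow> finite (V i)"
    and f: "\<And>B w. B \<subseteq> S \<Longrightarrow> f (restrict w B) B = f w B"
    and g: "\<And>B. B \<subseteq> S \<Longrightarrow> g B = (\<Prod>i\<in>B. c i) * (\<Sum>w\<in>PiE B V. f w B)"
  shows "cumulant g S = (\<Prod>i\<in>S. c i) * (\<Sum>w\<in>PiE S V. cumulant (f w) S)"
proof -
  have "(\<Prod>B\<in>P. g B) = (\<Prod>i\<in>S. c i) * (\<Sum>w\<in>PiE S V. \<Prod>B\<in>P. f w B)" if P: "partition_on S P" for P
  proof -
    have BS: "B \<subseteq> S" if "B \<in> P" for B using P that by (auto simp: partition_on_def)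
    have "(\<Prod>B\<in>P. g B) = (\<Prod>B\<in>P. \<Prod>i\<in>B. c i) * (\<Prod>B\<in>P. \<Sum>w\<in>PiE B V. f w B)"
      using g BS by (simp add: prod.distrib)
    also have "(\<Prod>B\<in>P. \<Sum>w\<in>PiE B V. f w B) = (\<Sum>w\<in>PiE S V. \<Prod>B\<in>P. f w B)"
      by (rule prod_partition_sum_PiE[OF S P V, where F = "\<lambda>B w. f w B"]) (use f BS in auto)
    also have "(\<Prod>B\<in>P. \<Prod>i\<in>B. c i) = (\<Prod>i\<in>\<Union>P. c i)"
      using P BS S by (subst prod.Union_disjoint) (auto simp: partition_on_def disjoint_def intro: finite_subset)
    also have "\<Union>P = S" using P by (simp add: partition_on_def)
    finally show ?thesis .
  qed
  then have "cumulant g S = (\<Sum>P | partition_on S P. \<Sum>w\<in>PiE S V. (\<Prod>i\<in>S. c i) *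
      ((- 1) ^ (card P - 1) * fact (card P - 1) * (\<Prod>B\<in>P. f w B)))"
    unfolding cumulant_def by (intro sum.cong refl) (simp add: sum_distrib_left mult_ac)
  also have "\<dots> = (\<Sum>w\<in>PiE S V. \<Sum>P | partition_on S P. (\<Prod>i\<in>S. c i) *
      ((- 1) ^ (card P - 1) * fact (card P - 1) * (\<Prod>B\<in>P. f w B)))"
    by (rule sum.swap)
  finally show ?thesis by (simp add: cumulant_def sum_distrib_left)
qed

section \<open>Traces of powers as sums over closed paths\<close>

lemma sum_PiE_insert:
  assumes "x \<notin> I"
  shows "(\<Sum>v\<in>PiE (insert x I) V. h v) = (\<Sum>v\<in>PiE I V. \<Sum>y\<in>V x. h (v(x := y)))"
proof -
  have "(\<Sum>v\<in>PiE (insert x I) V. h v) = (\<Sum>(y, v)\<in>V x \<times> PiE I V. h (v(x := y)))"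
    unfolding PiE_insert_eq
    by (subst sum.reindex[OF inj_combinator[OF assms]]) (simp add: o_def case_prod_unfold)
  also have "\<dots> = (\<Sum>y\<in>V x. \<Sum>v\<in>PiE I V. h (v(x := y)))"
    by (simp add: sum.cartesian_product)
  finally show ?thesis by (subst sum.swap) 
qed

text \<open>The weight \<phi> on the end points is arbitrary so that the induction can absorb the
  last step of the path into it; choosing an entry as weight later closes the path.\<close>

lemma sum_pow_mat_paths:
  fixes f :: "nat \<times> nat \<Rightarrow> 'a::comm_semiring_1"
  shows "(\<Sum>i<n. \<Sum>i'<n. (Matrix.mat n n f ^\<^sub>m m) $$ (i, i') * \<phi> i i')
    = (\<Sum>v\<in>PiE {..m} (\<lambda>_. {..<n}). \<phi> (v 0) (v m) * (\<Prod>l<m. f (v l, v (Suc l))))"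
proof (induction m arbitrary: \<phi>)
  case 0
  have "{..0::nat} = insert 0 {}" by auto
  then show ?case
    by (simp only:, subst sum_PiE_insert) (simp_all add: if_distrib[of "\<lambda>x. x * _"] sum.delta' cong: if_cong)
next
  case (Suc m)
  let ?A = "Matrix.mat n n f"
  have carr: "?A ^\<^sub>m m \<in> carrier_mat n n" by (intro pow_carrier_mat) auto
  have "(\<Sum>i<n. \<Sum>i'<n. (?A ^\<^sub>m Suc m) $$ (i, i') * \<phi> i i')
      = (\<Sum>i<n. \<Sum>i'<n. (\<Sum>y<n. (?A ^\<^sub>m m) $$ (i, y) * f (y, i')) * \<phi> i i')"
    using carr by (intro sum.cong refl arg_cong2[of _ _ _ _ "(*)"])
      (auto simp: scalar_prod_def atLeast0LessThan intro!: sum.cong)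
  also have "\<dots> = (\<Sum>i<n. \<Sum>y<n. (?A ^\<^sub>m m) $$ (i, y) * (\<Sum>i'<n. f (y, i') * \<phi> i i'))"
    by (simp add: sum_distrib_left sum_distrib_right mult.assoc)
       (intro sum.cong refl sum.swap)
  also have "\<dots> = (\<Sum>v\<in>PiE {..m} (\<lambda>_. {..<n}).
      (\<Sum>i'<n. f (v m, i') * \<phi> (v 0) i') * (\<Prod>l<m. f (v l, v (Suc l))))"
    by (rule Suc.IH)
  also have "\<dots> = (\<Sum>v\<in>PiE (insert (Suc m) {..m}) (\<lambda>_. {..<n}).
      \<phi> (v 0) (v (Suc m)) * (\<Prod>l<Suc m. f (v l, v (Suc l))))"
    by (subst sum_PiE_insert) (simp_all add: sum_distrib_left sum_distrib_right mult_ac)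
  finally show ?case by (simp add: atMost_Suc)
qed

lemma mat_trace_pow:
  fixes f :: "nat \<times> nat \<Rightarrow> 'a::comm_semiring_1"
  assumes "m \<ge> 1"
  shows "mat_trace (Matrix.mat n n f ^\<^sub>m m)
    = (\<Sum>v\<in>PiE {..<m} (\<lambda>_. {..<n}). \<Prod>l<m. f (v l, v (Suc l mod m)))"
proof -
  obtain t where t: "m = Suc t" using assms by (cases m) auto
  let ?A = "Matrix.mat n n f"
  have carr: "?A ^\<^sub>m t \<in> carrier_mat n n" by (intro pow_carrier_mat) auto
  have "mat_trace (?A ^\<^sub>m m) = (\<Sum>i<n. \<Sum>i'<n. (?A ^\<^sub>m t) $$ (i, i') * f (i', i))"
    unfolding mat_trace_def t using carr
    by (auto simp: scalar_prod_def atLeast0LessThan intro!: sum.cong)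
  also have "\<dots> = (\<Sum>v\<in>PiE {..t} (\<lambda>_. {..<n}). f (v t, v 0) * (\<Prod>l<t. f (v l, v (Suc l))))"
    by (rule sum_pow_mat_paths[where \<phi> = "\<lambda>i i'. f (i', i)"])
  also have "\<dots> = (\<Sum>v\<in>PiE {..<m} (\<lambda>_. {..<n}). \<Prod>l<m. f (v l, v (Suc l mod m)))"
    unfolding t lessThan_Suc_atMost
    by (intro sum.cong refl) (simp add: lessThan_Suc mult.commute flip: lessThan_Suc_atMost)
  finally show ?thesis .
qed

section \<open>Moments of products of entries\<close>

text \<open>Every factor is at most the largest one; the summand 1 covers the empty product.\<close>

lemma prod_le_one_plus_sum_power:
  fixes y :: "'p \<Rightarrow> real"
  assumes T: "finite T" and y: "\<And>p. p \<in> T \<Longrightarrow> y p \<ge> 0"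
  shows "(\<Prod>p\<in>T. y p) \<le> 1 + (\<Sum>p\<in>T. y p ^ card T)"
proof (cases "T = {}")
  case False
  have "Max (y ` T) \<in> y ` T" using T False by (intro Max_in) auto
  then obtain q where q: "q \<in> T" "y q = Max (y ` T)" by auto
  have "(\<Prod>p\<in>T. y p) \<le> (\<Prod>p\<in>T. y q)"
    using T y by (intro prod_mono) (auto simp: q)
  also have "\<dots> \<le> (\<Sum>p\<in>T. y p ^ card T)"
    using member_le_sum[of q T "\<lambda>p. y p ^ card T"] T y q(1) by simp
  finally show ?thesis by simp
qed simp

context correlated_ensemble
begin

text \<open>The constant \<open>m_k\<close> of the ensemble at \<open>k = m\<close>, as a real
  number; by \<open>moments\<close> it is finite, so \<open>enn2real\<close> keeps its
  value.\<close>

definition moment_bound :: "nat \<Rightarrow> real" where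
  "moment_bound m = enn2real (SUP n\<in>{1..}. MAX x\<in>{1..n} \<times> {1..n}.
     \<integral>\<^sup>+\<omega>. ennreal (cmod (a n x \<omega>) ^ m) \<partial>M n)"

text \<open>Measurability is contained in the independence assumption, here for a family with one
  representative.\<close>

lemma measurable_entry:
  assumes "n \<ge> 1" "x \<in> {1..n} \<times> {1..n}"
  shows "a n x \<in> borel_measurable (M n)"
proof -
  interpret prob_space "M n" using prob[OF assms(1)] .
  have "indep_vars (\<lambda>_. borel) (a n) {x}"
    by (rule indep_representatives[OF assms(1)]) (use assms in auto)
  then show ?thesis by (simp add: indep_vars_def2)
qed

lemma nn_moment_le:
  assumes n: "n \<ge> 1" and x: "x \<in> {1..n} \<times> {1..n}"
  shows "(\<integral>\<^sup>+\<omega>. ennreal (cmod (a n x \<omega>) ^ m) \<partial>M n) \<le> ennreal (moment_bound m)"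
proof -
  let ?N = "\<lambda>n x. \<integral>\<^sup>+\<omega>. ennreal (cmod (a n x \<omega>) ^ m) \<partial>M n"
  have "?N n x \<le> (MAX x\<in>{1..n} \<times> {1..n}. ?N n x)"
    using x by (intro Max_ge) auto
  also have "\<dots> \<le> (SUP n\<in>{1..}. MAX x\<in>{1..n} \<times> {1..n}. ?N n x)"
    using n by (intro SUP_upper) auto
  also have "\<dots> = ennreal (moment_bound m)"
    unfolding moment_bound_def using moments[of m] by (subst ennreal_enn2real) auto
  finally show ?thesis .
qed

lemma
  assumes n: "n \<ge> 1" and x: "x \<in> {1..n} \<times> {1..n}"
  shows integrable_moment: "integrable (M n) (\<lambda>\<omega>. cmod (a n x \<omega>) ^ m)"
    and moment_le: "(\<integral>\<omega>. cmod (a n x \<omega>) ^ m \<partial>M n) \<le> moment_bound m"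
proof -
  have meas: "(\<lambda>\<omega>. cmod (a n x \<omega>) ^ m) \<in> borel_measurable (M n)"
    using measurable_entry[OF n x] by measurable
  show int: "integrable (M n) (\<lambda>\<omega>. cmod (a n x \<omega>) ^ m)"
    using nn_moment_le[OF n x, of m]
    by (intro integrableI_nonneg meas) (auto intro: le_less_trans)
  have "ennreal (\<integral>\<omega>. cmod (a n x \<omega>) ^ m \<partial>M n) \<le> ennreal (moment_bound m)"
    using nn_moment_le[OF n x, of m] nn_integral_eq_integral[OF int] by simp
  then show "(\<integral>\<omega>. cmod (a n x \<omega>) ^ m \<partial>M n) \<le> moment_bound m"
    by (simp add: moment_bound_def ennreal_le_iff)
qed

lemma
  assumes n: "n \<ge> 1" and T: "finite T" and x: "\<And>p. p \<in> T \<Longrightarrow> x p \<in> {1..n} \<times> {1..n}"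
  shows integrable_prod_entries: "integrable (M n) (\<lambda>\<omega>. \<Prod>p\<in>T. a n (x p) \<omega>)"
    and norm_expectation_prod_entries:
      "cmod (\<integral>\<omega>. (\<Prod>p\<in>T. a n (x p) \<omega>) \<partial>M n) \<le> 1 + card T * moment_bound (card T)"
proof -
  interpret prob_space "M n" using prob[OF n] .
  let ?b = "\<lambda>\<omega>. 1 + (\<Sum>p\<in>T. cmod (a n (x p) \<omega>) ^ card T)"
  have int_b: "integrable (M n) ?b"
    using integrable_moment[OF n x] by (intro Bochner_Integration.integrable_add integrable_sum) auto
  have le: "cmod (\<Prod>p\<in>T. a n (x p) \<omega>) \<le> ?b \<omega>" for \<omega>
    using prod_le_one_plus_sum_power[OF T, of "\<lambda>p. cmod (a n (x p) \<omega>)"] by (simp add: prod_norm)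
  have meas: "(\<lambda>\<omega>. \<Prod>p\<in>T. a n (x p) \<omega>) \<in> borel_measurable (M n)"
    using measurable_entry[OF n x] by (intro borel_measurable_prod) auto
  show int: "integrable (M n) (\<lambda>\<omega>. \<Prod>p\<in>T. a n (x p) \<omega>)"
    by (rule Bochner_Integration.integrable_bound[OF int_b meas]) (use le in \<open>fastforce intro: order_trans[OF _ abs_ge_self]\<close>)
  have "cmod (\<integral>\<omega>. (\<Prod>p\<in>T. a n (x p) \<omega>) \<partial>M n) \<le> (\<integral>\<omega>. cmod (\<Prod>p\<in>T. a n (x p) \<omega>) \<partial>M n)"
    by (rule integral_norm_bound)
  also have "\<dots> \<le> (\<integral>\<omega>. ?b \<omega> \<partial>M n)"
    using int int_b le by (intro integral_mono integrable_norm) auto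
  also have "\<dots> = 1 + (\<Sum>p\<in>T. \<integral>\<omega>. cmod (a n (x p) \<omega>) ^ card T \<partial>M n)"
    using integrable_moment[OF n x] by (subst Bochner_Integration.integral_add) (auto simp: prob_space)
  also have "\<dots> \<le> 1 + (\<Sum>p\<in>T. moment_bound (card T))"
    using moment_le[OF n x] by (intro add_left_mono sum_mono) auto
  finally show "cmod (\<integral>\<omega>. (\<Prod>p\<in>T. a n (x p) \<omega>) \<partial>M n) \<le> 1 + card T * moment_bound (card T)"
    by simp
qed

text \<open>The factors are grouped by matrix class. Each group is a measurable function of the
  family of entries in its class, and these families are independent.\<close>

lemma expectation_prod_classes:
  assumes n: "n \<ge> 1" and T: "finite T" and x: "\<And>p. p \<in> T \<Longrightarrow> x p \<in> {1..n} \<times> {1..n}"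
  shows "(\<integral>\<omega>. (\<Prod>p\<in>T. a n (x p) \<omega>) \<partial>M n)
    = (\<Prod>c\<in>({1..n} \<times> {1..n}) // R n. \<integral>\<omega>. (\<Prod>p\<in>{p \<in> T. x p \<in> c}. a n (x p) \<omega>) \<partial>M n)"
proof -
  interpret prob_space "M n" using prob[OF n] .
  have eq: "equiv ({1..n} \<times> {1..n}) (R n)" using equiv_R[OF n] .
  let ?Q = "({1..n} \<times> {1..n}) // R n"
  let ?Z = "\<lambda>c \<omega>. \<Prod>p\<in>{p \<in> T. x p \<in> c}. a n (x p) \<omega>"
  have finQ: "finite ?Q" using eq by (intro finite_quotient) (auto simp: equiv_def)
  have "indep_vars (\<lambda>_. borel) (\<lambda>c \<omega>. \<Prod>p\<in>{p \<in> T. x p \<in> c}. (\<lambda>y\<in>c. a n y \<omega>) (x p)) ?Q"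
    by (rule indep_vars_compose2[OF indep_classes[OF n], where Y = "\<lambda>c v. \<Prod>p\<in>{p \<in> T. x p \<in> c}. v (x p)"])
       (intro borel_measurable_prod measurable_component_singleton, simp)
  then have indep: "indep_vars (\<lambda>_. borel) ?Z ?Q" by simp
  have "(\<Prod>p\<in>T. a n (x p) \<omega>) = (\<Prod>c\<in>?Q. ?Z c \<omega>)" for \<omega>
  proof -
    have "(\<Prod>p\<in>T. a n (x p) \<omega>) = (\<Prod>c\<in>?Q. \<Prod>p\<in>{p. p \<in> T \<and> R n `` {x p} = c}. a n (x p) \<omega>)"
      by (rule prod.group[symmetric]) (use T finQ x in \<open>auto intro!: quotientI\<close>)
    also have "\<dots> = (\<Prod>c\<in>?Q. ?Z c \<omega>)"
    proof (intro prod.cong refl)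
      fix c p assume c: "c \<in> ?Q"
      show "{p. p \<in> T \<and> R n `` {x p} = c} = {p \<in> T. x p \<in> c}"
      proof (intro Collect_cong conj_cong refl)
        fix p assume "p \<in> T"
        then have xp: "x p \<in> {1..n} \<times> {1..n}" by (rule x)
        show "(R n `` {x p} = c) = (x p \<in> c)"
          using c xp equiv_class_self[OF eq xp] equiv_class_eq_iff[OF eq] by (auto simp: quotient_def)
      qed
    qed
    finally show ?thesis .
  qed
  then have "(\<integral>\<omega>. (\<Prod>p\<in>T. a n (x p) \<omega>) \<partial>M n) = (\<integral>\<omega>. (\<Prod>c\<in>?Q. ?Z c \<omega>) \<partial>M n)" by simp
  also have "\<dots> = (\<Prod>c\<in>?Q. \<integral>\<omega>. ?Z c \<omega> \<partial>M n)"
    by (rule indep_vars_lebesgue_integral[OF finQ indep])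
       (use T x in \<open>auto intro!: integrable_prod_entries[OF n]\<close>)
  finally show ?thesis .
qed

end

section \<open>Cumulants of traces\<close>

context correlated_ensemble
begin

text \<open>As a set function of \<open>B\<close> these are the mixed moments of the path products
  along the circles labelled by \<open>u\<close>, so \<open>cumulant\<close> turns them into a joint
  cumulant of path products.\<close>

definition circle_moment :: "nat \<Rightarrow> (nat \<Rightarrow> nat) \<Rightarrow> (nat \<times> nat \<Rightarrow> nat) \<Rightarrow> nat set \<Rightarrow> complex" where
  "circle_moment n k u B = (\<integral>\<omega>. (\<Prod>p\<in>Sigma B (\<lambda>i. {..<k i}). a n (edge k u p) \<omega>) \<partial>M n)"

lemma nxt_in_Sigma: "p \<in> Sigma B (\<lambda>i. {..<k i}) \<Longrightarrow> nxt k p \<in> Sigma B (\<lambda>i. {..<k i})"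
  by (auto simp: nxt_def intro!: mod_less_divisor)

lemma edge_in_range:
  assumes "u \<in> Sigma B (\<lambda>i. {..<k i}) \<rightarrow> {..<n}" "p \<in> Sigma B (\<lambda>i. {..<k i})"
  shows "edge k u p \<in> {1..n} \<times> {1..n}"
  using funcset_mem[OF assms] funcset_mem[OF assms(1) nxt_in_Sigma[OF assms(2)]]
  by (simp add: edge_def)

lemma circle_moment_empty: "n \<ge> 1 \<Longrightarrow> circle_moment n k u {} = 1"
  using prob_space.prob_space[OF prob] by (simp add: circle_moment_def)

lemma circle_moment_cong:
  assumes "\<And>p. p \<in> Sigma B (\<lambda>i. {..<k i}) \<Longrightarrow> u p = v p"
  shows "circle_moment n k u B = circle_moment n k v B"
  unfolding circle_moment_def
proof (intro Bochner_Integration.integral_cong prod.cong refl)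
  fix p \<omega> assume p: "p \<in> Sigma B (\<lambda>i. {..<k i})"
  show "a n (edge k u p) \<omega> = a n (edge k v p) \<omega>"
    using assms[OF p] assms[OF nxt_in_Sigma[OF p]] by (simp add: edge_def)
qed

lemma trace_pow_ensemble:
  assumes "m \<ge> 1"
  shows "mat_trace (ensemble_mat a n \<omega> ^\<^sub>m m) = complex_of_real (1 / sqrt (real n)) ^ m *
    (\<Sum>v\<in>PiE {..<m} (\<lambda>_. {..<n}). \<Prod>l<m. a n (Suc (v l), Suc (v (Suc l mod m))) \<omega>)"
proof -
  let ?c = "complex_of_real (1 / sqrt (real n))"
  have "ensemble_mat a n \<omega> = Matrix.mat n n (\<lambda>(i, j). ?c * a n (Suc i, Suc j) \<omega>)"
    unfolding ensemble_mat_def by (rule eq_matI) auto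
  then show ?thesis
    by (simp only: mat_trace_pow[OF assms] prod.case prod.distrib prod_constant card_lessThan sum_distrib_left)
qed

text \<open>Each trace is a scalar times a sum over the labellings of its own circle, so
  \<open>cumulant_sum\<close> applies; \<open>w\<close> collects one labelling per circle.\<close>

lemma joint_cumulant_traces:
  assumes n: "n \<ge> 1" and k: "\<And>i. i \<in> {1..j} \<Longrightarrow> k i \<ge> 1"
  shows "joint_cumulant (M n) j (\<lambda>i \<omega>. mat_trace (ensemble_mat a n \<omega> ^\<^sub>m k i))
    = (\<Prod>i\<in>{1..j}. complex_of_real (1 / sqrt (real n)) ^ k i) *
      (\<Sum>w\<in>PiE {1..j} (\<lambda>i. PiE {..<k i} (\<lambda>_. {..<n})).
        cumulant (circle_moment n k (\<lambda>p. w (fst p) (snd p))) {1..j})"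
proof -
  let ?c = "complex_of_real (1 / sqrt (real n))"
  let ?V = "\<lambda>i. PiE {..<k i} (\<lambda>_. {..<n})"
  define g where "g B = (\<integral>\<omega>. (\<Prod>i\<in>B. mat_trace (ensemble_mat a n \<omega> ^\<^sub>m k i)) \<partial>M n)" for B
  have finV: "finite (?V i)" for i by (intro finite_PiE) auto
  have "cumulant g {1..j} = (\<Prod>i\<in>{1..j}. ?c ^ k i) *
      (\<Sum>w\<in>PiE {1..j} ?V. cumulant (circle_moment n k (\<lambda>p. w (fst p) (snd p))) {1..j})"
  proof (rule cumulant_sum)
    fix B w assume "B \<subseteq> {1..j}"
    show "circle_moment n k (\<lambda>p. restrict w B (fst p) (snd p)) B = circle_moment n k (\<lambda>p. w (fst p) (snd p)) B"
      by (rule circle_moment_cong) auto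
  next
    fix B assume B: "B \<subseteq> {1..j}"
    then have finB: "finite B" by (rule finite_subset) simp
    let ?e = "\<lambda>w. edge k (\<lambda>p. w (fst p) (snd p))"
    have range: "?e w p \<in> {1..n} \<times> {1..n}" if "w \<in> PiE B ?V" "p \<in> Sigma B (\<lambda>i. {..<k i})" for w p
    proof (rule edge_in_range[OF _ that(2)])
      show "(\<lambda>p. w (fst p) (snd p)) \<in> Sigma B (\<lambda>i. {..<k i}) \<rightarrow> {..<n}"
        using that(1) by (auto simp: PiE_iff)
    qed
    have "(\<Prod>i\<in>B. mat_trace (ensemble_mat a n \<omega> ^\<^sub>m k i)) = (\<Prod>i\<in>B. ?c ^ k i) *
        (\<Sum>w\<in>PiE B ?V. \<Prod>p\<in>Sigma B (\<lambda>i. {..<k i}). a n (?e w p) \<omega>)" for \<omega>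
    proof -
      have "(\<Prod>i\<in>B. mat_trace (ensemble_mat a n \<omega> ^\<^sub>m k i)) =
          (\<Prod>i\<in>B. ?c ^ k i * (\<Sum>v\<in>?V i. \<Prod>l<k i. a n (Suc (v l), Suc (v (Suc l mod k i))) \<omega>))"
        using B k by (intro prod.cong refl trace_pow_ensemble) auto
      also have "\<dots> = (\<Prod>i\<in>B. ?c ^ k i) *
          (\<Sum>w\<in>PiE B ?V. \<Prod>i\<in>B. \<Prod>l<k i. a n (Suc (w i l), Suc (w i (Suc l mod k i))) \<omega>)"
        unfolding prod.distrib by (subst prod_sum_PiE[OF finB finV]) simp
      also have "(\<Sum>w\<in>PiE B ?V. \<Prod>i\<in>B. \<Prod>l<k i. a n (Suc (w i l), Suc (w i (Suc l mod k i))) \<omega>)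
          = (\<Sum>w\<in>PiE B ?V. \<Prod>p\<in>Sigma B (\<lambda>i. {..<k i}). a n (?e w p) \<omega>)"
        by (intro sum.cong refl, subst prod.Sigma)
           (auto simp: finB edge_def nxt_def intro!: prod.cong)
      finally show ?thesis .
    qed
    then have "g B = (\<integral>\<omega>. (\<Prod>i\<in>B. ?c ^ k i) *
        (\<Sum>w\<in>PiE B ?V. \<Prod>p\<in>Sigma B (\<lambda>i. {..<k i}). a n (?e w p) \<omega>) \<partial>M n)"
      by (simp add: g_def)
    also have "\<dots> = (\<Prod>i\<in>B. ?c ^ k i) *
        (\<integral>\<omega>. (\<Sum>w\<in>PiE B ?V. \<Prod>p\<in>Sigma B (\<lambda>i. {..<k i}). a n (?e w p) \<omega>) \<partial>M n)"
      by (rule integral_mult_right_zero)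
    also have "(\<integral>\<omega>. (\<Sum>w\<in>PiE B ?V. \<Prod>p\<in>Sigma B (\<lambda>i. {..<k i}). a n (?e w p) \<omega>) \<partial>M n)
        = (\<Sum>w\<in>PiE B ?V. \<integral>\<omega>. (\<Prod>p\<in>Sigma B (\<lambda>i. {..<k i}). a n (?e w p) \<omega>) \<partial>M n)"
      by (rule Bochner_Integration.integral_sum, rule integrable_prod_entries[OF n])
         (use finB range in auto)
    finally show "g B = (\<Prod>i\<in>B. ?c ^ k i) *
        (\<Sum>w\<in>PiE B ?V. circle_moment n k (\<lambda>p. w (fst p) (snd p)) B)"
      by (simp add: circle_moment_def)
  qed (auto intro: finV)
  moreover have "joint_cumulant (M n) j (\<lambda>i \<omega>. mat_trace (ensemble_mat a n \<omega> ^\<^sub>m k i)) = cumulant g {1..j}"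
    by (simp add: joint_cumulant_def cumulant_def g_def)
  ultimately show ?thesis by simp
qed

section \<open>From non-vanishing cumulants to few vertex configurations\<close>

definition pattern :: "nat \<Rightarrow> (nat \<Rightarrow> nat) \<Rightarrow> (nat \<times> nat) set \<Rightarrow> (nat \<times> nat \<Rightarrow> nat) \<Rightarrow>
    ((nat \<times> nat) \<times> (nat \<times> nat)) set" where
  "pattern n k P u = {(p, q) \<in> P \<times> P. (edge k u p, edge k u q) \<in> R n}"

text \<open>The pattern is the equivalence relation on edges pulled back from \<open>R n\<close>,
  and a nonzero cumulant yields the hypotheses of \<open>determining_set\<close>: circles sharing no
  class across a split make the moments factor, and an edge alone in its class brings in a centered
  factor.\<close>

lemma determining_set_if_cumulant_nonzero:
  assumes n: "n \<ge> 1" and k: "\<And>i. i \<in> {1..j} \<Longrightarrow> k i \<ge> 1" and j: "j \<ge> 3"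
    and P_def: "P = Sigma {1..j} (\<lambda>i. {..<k i})"
    and u: "u \<in> P \<rightarrow> {..<n}"
    and nz: "cumulant (circle_moment n k u) {1..j} \<noteq> 0"
  shows "\<exists>D\<subseteq>P. 2 * card D < card P \<and> edge_closed k (pattern n k P u) hull D = P"
proof -
  define r where "r = pattern n k P u"
  let ?Q = "({1..n} \<times> {1..n}) // R n"
  have eq: "equiv ({1..n} \<times> {1..n}) (R n)" using equiv_R[OF n] .
  have range: "edge k u p \<in> {1..n} \<times> {1..n}" if "p \<in> P" for p
    using edge_in_range[of u "{1..j}" k n p] u that by (simp add: P_def)
  have finP: "finite P" by (simp add: P_def)
  have r_iff: "(p, q) \<in> r \<longleftrightarrow> p \<in> P \<and> q \<in> P \<and> (edge k u p, edge k u q) \<in> R n" for p q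
    by (auto simp: r_def pattern_def)
  have refl: "(x, x) \<in> R n" if "x \<in> {1..n} \<times> {1..n}" for x
    using eq that by (meson equivE refl_onD)
  have sym: "(y, x) \<in> R n" if "(x, y) \<in> R n" for x y
    using eq that by (meson equivE symD)
  have trans: "(x, z) \<in> R n" if "(x, y) \<in> R n" "(y, z) \<in> R n" for x y z
    using eq that by (meson equivE transD)
  have eqr: "equiv P r"
  proof (rule equivI)
    show "r \<subseteq> P \<times> P" using r_iff by auto
    show "refl_on P r" by (rule refl_onI) (use r_iff refl range in auto)
    show "sym r" by (rule symI) (use r_iff sym in auto)
    show "trans r" by (rule transI) (use r_iff trans in blast)
  qed
  interpret coloured_circles "{1..j}" k r
    by unfold_locales (use k eqr in \<open>auto simp: P_def\<close>)
  define E where "E T = (\<integral>\<omega>. (\<Prod>p\<in>T. a n (edge k u p) \<omega>) \<partial>M n)" for T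
  have E0: "E {} = 1" using prob_space.prob_space[OF prob[OF n]] by (simp add: E_def)
  define cl where "cl c B = {p \<in> Sigma B (\<lambda>i. {..<k i}). edge k u p \<in> c}" for c B
  \<comment> \<open>Matrix classes that are not visited contribute an empty product with expectation
    1.\<close>
  have cm: "circle_moment n k u B = (\<Prod>c\<in>?Q. E (cl c B))" if B: "B \<subseteq> {1..j}" for B
  proof -
    have "Sigma B (\<lambda>i. {..<k i}) \<subseteq> P" using B by (auto simp: P_def)
    then show ?thesis
      unfolding circle_moment_def E_def cl_def
      by (intro expectation_prod_classes n finite_subset[OF _ finP] range) auto
  qed
  have finQ: "finite ?Q" using eq by (intro finite_quotient) (auto simp: equiv_def)
  have conn: "\<exists>p q. (p, q) \<in> r \<and> fst p \<in> J \<and> fst q \<notin> J" if J: "J \<subset> {1..j}" "J \<noteq> {}" for J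
  proof (rule ccontr)
    assume no: "\<not> (\<exists>p q. (p, q) \<in> r \<and> fst p \<in> J \<and> fst q \<notin> J)"
    obtain x y where xy: "x \<in> J" "x \<in> {1..j}" "y \<in> {1..j}" "y \<notin> J" using J by blast
    have "cumulant (circle_moment n k u) {1..j} = 0"
    proof (rule cumulant_split[where J = J and x = x and y = y])
      fix B assume B: "B \<subseteq> {1..j}"
      have "E (cl c B) = E (cl c (B \<inter> J)) * E (cl c (B - J))" if c: "c \<in> ?Q" for c
      proof -
        \<comment> \<open>No class meets both groups of circles, so in each class one of the two
          factors is \<open>E {} = 1\<close>.\<close>
        have "cl c (B \<inter> J) = {} \<or> cl c (B - J) = {}"
        proof (rule ccontr)
          assume "\<not> ?thesis"
          then obtain p q where pq: "p \<in> cl c (B \<inter> J)" "q \<in> cl c (B - J)" by blast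
          then have "p \<in> P" "q \<in> P" "fst p \<in> J" "fst q \<notin> J" "edge k u p \<in> c" "edge k u q \<in> c"
            using B by (auto simp: cl_def P_def)
          then have "(p, q) \<in> r" using r_iff quotient_eq_iff[OF eq c c] by blast
          then show False using no \<open>fst p \<in> J\<close> \<open>fst q \<notin> J\<close> by blast
        qed
        moreover have "cl c B = cl c (B \<inter> J) \<union> cl c (B - J)" by (auto simp: cl_def)
        ultimately show ?thesis using E0 by auto
      qed
      moreover have "B \<inter> J \<subseteq> {1..j}" "B - J \<subseteq> {1..j}" using B by auto
      ultimately show "circle_moment n k u B = circle_moment n k u (B \<inter> J) * circle_moment n k u (B - J)"
        using B by (simp add: cm prod.distrib[symmetric])
    qed (use xy circle_moment_empty[OF n] in auto)
    then show False using nz by simp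
  qed
  have two: "card B \<ge> 2" if B: "B \<in> P // r" for B
  proof (rule ccontr)
    assume "\<not> card B \<ge> 2"
    obtain p where p: "p \<in> B" "p \<in> P" "B = r `` {p}"
      using B eqr by (auto simp: quotient_def dest: equiv_class_self)
    have finB: "finite B" using B finP Union_quotient[OF eqr] by (metis Union_upper finite_subset)
    have "card {p} \<le> card B" using p(1) finB by (intro card_mono) auto
    then have "{p} = B"
      using p(1) finB \<open>\<not> card B \<ge> 2\<close> by (intro card_subset_eq) auto
    then have only: "q = p" if "q \<in> P" "(edge k u p, edge k u q) \<in> R n" for q
      using that p(2,3) \<open>{p} = B\<close> r_iff by blast
    \<comment> \<open>The factor for the class of \<open>p\<close> is the expectation of a single
      centered entry. Every partition has a block containing the circle of \<open>p\<close>, so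
      every term of the cumulant vanishes.\<close>
    have zero: "circle_moment n k u B' = 0" if B': "B' \<subseteq> {1..j}" "fst p \<in> B'" for B'
    proof -
      let ?c = "R n `` {edge k u p}"
      have c: "?c \<in> ?Q" using range[OF p(2)] by (rule quotientI)
      have "cl ?c B' = {p}"
        using only p(2) B' refl[OF range[OF p(2)]] by (fastforce simp: cl_def P_def)
      then have "E (cl ?c B') = 0"
        using centered[OF n] range[OF p(2)] by (cases "edge k u p") (auto simp: E_def)
      then show ?thesis using cm[OF B'(1)] c finQ by (auto intro: prod_zero)
    qed
    have "cumulant (circle_moment n k u) {1..j} = 0"
      unfolding cumulant_def
    proof (rule sum.neutral, intro ballI)
      fix \<pi> assume "\<pi> \<in> {\<pi>. partition_on {1..j} \<pi>}"
      then have \<pi>: "partition_on {1..j} \<pi>" by simp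
      have "fst p \<in> {1..j}" using p(2) by (auto simp: P_def)
      then obtain B' where B': "B' \<in> \<pi>" "fst p \<in> B'" unfolding partition_onD1[OF \<pi>] by blast
      then have "B' \<subseteq> {1..j}" using partition_onD1[OF \<pi>] by blast
      have "(\<Prod>B\<in>\<pi>. circle_moment n k u B) = 0"
        using finite_partition[OF _ \<pi>] B' \<open>B' \<subseteq> {1..j}\<close> zero by (intro prod_zero) auto
      then show "(- 1) ^ (card \<pi> - 1) * fact (card \<pi> - 1) * (\<Prod>B\<in>\<pi>. circle_moment n k u B) = 0" by simp
    qed
    then show False using nz by simp
  qed
  have "\<exists>D\<subseteq>positions. 2 * card D < card positions \<and> infected D = positions"
    by (rule determining_set[OF conn]) (use j two in \<open>simp_all add: P_def\<close>)
  then show ?thesis by (simp only: P_def r_def)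
qed

text \<open>The bound is uniform in \<open>n\<close> and \<open>u\<close>: the moment bounds do not
  depend on them, and the partitions and numbers of edges depend only on \<open>j\<close> and
  \<open>k\<close>.\<close>

lemma cumulant_bounded:
  "\<exists>C\<ge>0. \<forall>n\<ge>1. \<forall>u\<in>Sigma {1..j} (\<lambda>i. {..<k i}) \<rightarrow> {..<n}.
     cmod (cumulant (circle_moment n k u) {1..j}) \<le> C"
proof -
  let ?P = "Sigma {1..j} (\<lambda>i. {..<k i})"
  define b where "b B = 1 + card (Sigma B (\<lambda>i. {..<k i})) * moment_bound (card (Sigma B (\<lambda>i. {..<k i})))" for B :: "nat set"
  have b: "cmod (circle_moment n k u B) \<le> b B" if "n \<ge> 1" "u \<in> ?P \<rightarrow> {..<n}" "B \<subseteq> {1..j}" for n u B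
  proof -
    have sub: "Sigma B (\<lambda>i. {..<k i}) \<subseteq> ?P" using that(3) by auto
    show ?thesis unfolding circle_moment_def b_def
      by (intro norm_expectation_prod_entries that finite_subset[OF sub] edge_in_range[OF that(2)]) (use sub in auto)
  qed
  define C where "C = (\<Sum>\<pi> | partition_on {1..j} \<pi>. fact (card \<pi> - 1) * (\<Prod>B\<in>\<pi>. b B))"
  have b0: "b B \<ge> 0" for B by (simp add: b_def moment_bound_def)
  have "cmod (cumulant (circle_moment n k u) {1..j}) \<le> C" if "n \<ge> 1" "u \<in> ?P \<rightarrow> {..<n}" for n u
    unfolding cumulant_def C_def
  proof (rule order_trans[OF norm_sum sum_mono])
    fix \<pi> assume "\<pi> \<in> {\<pi>. partition_on {1..j} \<pi>}"
    then have "B \<subseteq> {1..j}" if "B \<in> \<pi>" for B using that by (auto simp: partition_on_def)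
    then have "(\<Prod>B\<in>\<pi>. cmod (circle_moment n k u B)) \<le> (\<Prod>B\<in>\<pi>. b B)"
      using b[OF that] by (intro prod_mono) auto
    then show "cmod ((- 1) ^ (card \<pi> - 1) * fact (card \<pi> - 1) * (\<Prod>B\<in>\<pi>. circle_moment n k u B))
        \<le> fact (card \<pi> - 1) * (\<Prod>B\<in>\<pi>. b B)"
      by (simp add: norm_mult norm_power prod_norm[symmetric])
  qed
  moreover have "C \<ge> 0" unfolding C_def using b0 by (intro sum_nonneg mult_nonneg_nonneg prod_nonneg) auto
  ultimately show ?thesis by blast
qed

lemma class_card_le_alpha2:
  assumes n: "n \<ge> 1" and x: "x \<in> {1..n} \<times> {1..n}"
  shows "finite (R n `` {x})" "card (R n `` {x}) \<le> alpha2 n (R n)" "alpha2 n (R n) \<ge> 1"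
proof -
  have eq: "equiv ({1..n} \<times> {1..n}) (R n)" using equiv_R[OF n] .
  have "R n \<subseteq> ({1..n} \<times> {1..n}) \<times> ({1..n} \<times> {1..n})" using eq by (rule equivE)
  then have sub: "R n `` {x} = {y \<in> {1..n} \<times> {1..n}. (x, y) \<in> R n}" by auto
  then show fin: "finite (R n `` {x})" by simp
  show le: "card (R n `` {x}) \<le> alpha2 n (R n)"
    unfolding alpha2_def sub using x by (intro Max_ge) auto
  have "x \<in> R n `` {x}" by (rule equiv_class_self[OF eq x])
  then have "card (R n `` {x}) \<ge> 1" using fin by (metis One_nat_def Suc_leI card_gt_0_iff empty_iff)
  then show "alpha2 n (R n) \<ge> 1" using le by linarith
qed

text \<open>The configurations are covered by those with a given pattern, over all pairs of a
  pattern and a determining set. The number of such pairs is bounded independently of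
  \<open>n\<close>, and each is handled by \<open>card_configurations_le\<close>.\<close>

lemma card_nonzero_configurations:
  assumes n: "n \<ge> 1" and k: "\<And>i. i \<in> {1..j} \<Longrightarrow> k i \<ge> 1" and j: "j \<ge> 3"
    and P_def: "P = Sigma {1..j} (\<lambda>i. {..<k i})"
  shows "real (card {u \<in> PiE P (\<lambda>_. {..<n}). cumulant (circle_moment n k u) {1..j} \<noteq> 0})
    \<le> real (card (Pow (P \<times> P) \<times> Pow P)) * (sqrt (real n) ^ (card P - 1) * real (alpha2 n (R n)) ^ card P)"
proof -
  have finP: "finite P" by (simp add: P_def)
  let ?U = "{u \<in> PiE P (\<lambda>_. {..<n}). cumulant (circle_moment n k u) {1..j} \<noteq> 0}"
  define S where "S z = {u \<in> PiE P (\<lambda>_. {..<n}). pattern n k P u = fst z}" for z :: "((nat \<times> nat) \<times> (nat \<times> nat)) set \<times> (nat \<times> nat) set"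
  define Z where "Z = {z \<in> Pow (P \<times> P) \<times> Pow P. 2 * card (snd z) < card P \<and> edge_closed k (fst z) hull snd z = P}"
  have finZ: "finite Z" unfolding Z_def using finP by auto
  have finS: "finite (S z)" for z
    by (rule finite_subset[of _ "PiE P (\<lambda>_. {..<n})"]) (auto simp: S_def finP intro!: finite_PiE)
  have sub: "?U \<subseteq> (\<Union>z\<in>Z. S z)"
  proof
    fix u assume u: "u \<in> ?U"
    then have "u \<in> P \<rightarrow> {..<n}" by (auto simp: PiE_def)
    then obtain D where "D \<subseteq> P" "2 * card D < card P" "edge_closed k (pattern n k P u) hull D = P"
      using determining_set_if_cumulant_nonzero[OF n k j P_def] u by blast
    then have "(pattern n k P u, D) \<in> Z" "u \<in> S (pattern n k P u, D)"
      using u by (auto simp: Z_def S_def pattern_def)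
    then show "u \<in> (\<Union>z\<in>Z. S z)" by blast
  qed
  let ?b = "sqrt (real n) ^ (card P - 1) * real (alpha2 n (R n)) ^ card P"
  have S: "real (card (S z)) \<le> ?b" if "z \<in> Z" for z
  proof -
    obtain r D where z: "z = (r, D)" by (cases z)
    have D: "D \<subseteq> P" "2 * card D < card P" "edge_closed k r hull D = P" and r: "r \<subseteq> P \<times> P"
      using \<open>z \<in> Z\<close> by (auto simp: Z_def z)
    have one: "(1, 1) \<in> {1..n} \<times> {1..n}" using n by simp
    have "card (S z) \<le> n ^ card D * alpha2 n (R n) ^ card P"
      by (rule card_configurations_le[OF finP _ r _ D(1) D(3), where R = "R n"])
         (use class_card_le_alpha2[OF n] class_card_le_alpha2(3)[OF n one] nxt_in_Sigma[of _ "{1..j}" k]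
          in \<open>auto simp: S_def z pattern_def P_def\<close>)
    then have "real (card (S z)) \<le> real n ^ card D * real (alpha2 n (R n)) ^ card P"
      by (metis of_nat_le_iff of_nat_mult of_nat_power)
    \<comment> \<open>Powers of the square root express the half-integer exponent;
      \<open>2 * card D < card P\<close> saves one factor.\<close>
    also have "real n ^ card D = sqrt (real n) ^ (2 * card D)" by (simp add: power_mult)
    also have "sqrt (real n) ^ (2 * card D) \<le> sqrt (real n) ^ (card P - 1)"
      using n D(2) by (intro power_increasing) auto
    finally show ?thesis by (simp add: mult_right_mono)
  qed
  have "card ?U \<le> (\<Sum>z\<in>Z. card (S z))"
    using card_mono[OF _ sub] card_UN_le[OF finZ, of S] finZ finS by (meson finite_UN_I le_trans)
  then have "real (card ?U) \<le> (\<Sum>z\<in>Z. real (card (S z)))" by (simp flip: of_nat_sum)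
  also have "\<dots> \<le> (\<Sum>z\<in>Z. ?b)" by (rule sum_mono) (rule S)
  also have "\<dots> = real (card Z) * ?b" by simp
  also have "\<dots> \<le> real (card (Pow (P \<times> P) \<times> Pow P)) * ?b"
    using finP by (intro mult_right_mono of_nat_mono card_mono) (auto simp: Z_def)
  finally show ?thesis .
qed

text \<open>The normalisation contributes \<open>n\<close> to the power \<open>- K / 2\<close>,
  while the surviving configurations number at most a constant times \<open>n\<close> to the power
  \<open>(K - 1) / 2\<close> times \<alpha> to the power \<open>K\<close>, where \<alpha> is
  \<open>alpha2 n (R n)\<close>.\<close>

lemma joint_cumulant_traces_bound:
  assumes k: "\<And>i. i \<in> {1..j} \<Longrightarrow> k i \<ge> 1" and j: "j \<ge> 3"
  shows "\<exists>C. \<forall>n\<ge>1. cmod (joint_cumulant (M n) j (\<lambda>i \<omega>. mat_trace (ensemble_mat a n \<omega> ^\<^sub>m k i)))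
    \<le> C * (real (alpha2 n (R n)) ^ (\<Sum>i\<in>{1..j}. k i) / sqrt (real n))"
proof -
  define P where "P = Sigma {1..j} (\<lambda>i. {..<k i})"
  define K where "K = (\<Sum>i\<in>{1..j}. k i)"
  have cardP: "card P = K" by (simp add: P_def K_def)
  have finP: "finite P" by (simp add: P_def)
  have "k 1 \<le> K" unfolding K_def using j by (intro member_le_sum) auto
  then have K: "K \<ge> 1" using k[of 1] j by simp
  obtain C where C: "C \<ge> 0" "\<And>n u. n \<ge> 1 \<Longrightarrow> u \<in> P \<rightarrow> {..<n} \<Longrightarrow> cmod (cumulant (circle_moment n k u) {1..j}) \<le> C"
    using cumulant_bounded[of j k] unfolding P_def by blast
  define N where "N = real (card (Pow (P \<times> P) \<times> Pow P))"
  have "cmod (joint_cumulant (M n) j (\<lambda>i \<omega>. mat_trace (ensemble_mat a n \<omega> ^\<^sub>m k i)))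
      \<le> N * C * (real (alpha2 n (R n)) ^ K / sqrt (real n))" if n: "n \<ge> 1" for n
  proof -
    let ?\<alpha> = "real (alpha2 n (R n))"
    let ?W = "PiE {1..j} (\<lambda>i. PiE {..<k i} (\<lambda>_. {..<n}))"
    let ?c = "\<lambda>u. cumulant (circle_moment n k u) {1..j}"
    \<comment> \<open>Labellings per circle become functions on \<open>P\<close>, injectively, so
      that the count over \<open>P\<close> bounds the sum.\<close>
    define flat where "flat w = (\<lambda>p\<in>P. w (fst p) (snd p))" for w :: "nat \<Rightarrow> nat \<Rightarrow> nat"
    have flat: "flat ` ?W \<subseteq> PiE P (\<lambda>_. {..<n})"
    proof (rule image_subsetI)
      fix w assume w: "w \<in> ?W"
      have "w (fst p) (snd p) \<in> {..<n}" if "p \<in> P" for p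
      proof -
        have p: "fst p \<in> {1..j}" "snd p \<in> {..<k (fst p)}" using that by (auto simp: P_def)
        show ?thesis by (rule PiE_mem[OF PiE_mem[OF w p(1)] p(2)])
      qed
      then show "flat w \<in> PiE P (\<lambda>_. {..<n})"
        unfolding flat_def restrict_PiE_iff by blast
    qed
    have inj: "inj_on flat ?W"
    proof (rule inj_onI)
      fix v w assume vw: "v \<in> ?W" "w \<in> ?W" "flat v = flat w"
      show "v = w"
      proof (rule PiE_ext[OF vw(1,2)])
        fix i assume i: "i \<in> {1..j}"
        show "v i = w i"
        proof (rule PiE_ext)
          show "v i \<in> PiE {..<k i} (\<lambda>_. {..<n})" "w i \<in> PiE {..<k i} (\<lambda>_. {..<n})"
            using vw i by auto
          fix l assume "l \<in> {..<k i}"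
          then show "v i l = w i l" using fun_cong[OF vw(3), of "(i, l)"] i by (simp add: flat_def P_def)
        qed
      qed
    qed
    have finU: "finite (PiE P (\<lambda>_. {..<n}))" using finP by (intro finite_PiE) auto
    have same: "?c (\<lambda>p. w (fst p) (snd p)) = ?c (flat w)" for w
      unfolding cumulant_def
    proof (intro sum.cong prod.cong refl arg_cong2[of _ _ _ _ "(*)"])
      fix \<pi> B assume "\<pi> \<in> {\<pi>. partition_on {1..j} \<pi>}" "B \<in> \<pi>"
      then have "B \<subseteq> {1..j}" by (auto simp: partition_on_def)
      then show "circle_moment n k (\<lambda>p. w (fst p) (snd p)) B = circle_moment n k (flat w) B"
        by (intro circle_moment_cong) (auto simp: flat_def P_def)
    qed
    have "cmod (\<Sum>w\<in>?W. ?c (\<lambda>p. w (fst p) (snd p))) \<le> (\<Sum>w\<in>?W. cmod (?c (flat w)))"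
      unfolding same by (rule norm_sum)
    also have "\<dots> = (\<Sum>u\<in>flat ` ?W. cmod (?c u))" by (subst sum.reindex[OF inj]) (simp only: o_def)
    also have "\<dots> \<le> (\<Sum>u\<in>PiE P (\<lambda>_. {..<n}). cmod (?c u))"
      by (rule sum_mono2[OF finU flat]) simp
    also have "\<dots> = (\<Sum>u\<in>{u \<in> PiE P (\<lambda>_. {..<n}). ?c u \<noteq> 0}. cmod (?c u))"
      by (rule sum.mono_neutral_right[OF finU]) auto
    also have "\<dots> \<le> (\<Sum>u\<in>{u \<in> PiE P (\<lambda>_. {..<n}). ?c u \<noteq> 0}. C)"
      by (rule sum_mono) (use C(2)[OF n] in \<open>auto simp: PiE_def\<close>)
    also have "\<dots> = real (card {u \<in> PiE P (\<lambda>_. {..<n}). ?c u \<noteq> 0}) * C" by simp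
    also have "\<dots> \<le> N * (sqrt (real n) ^ (K - 1) * ?\<alpha> ^ K) * C"
      using card_nonzero_configurations[OF n k j P_def] C(1) unfolding N_def cardP
      by (intro mult_right_mono) auto
    finally have le: "cmod (\<Sum>w\<in>?W. ?c (\<lambda>p. w (fst p) (snd p))) \<le> N * (sqrt (real n) ^ (K - 1) * ?\<alpha> ^ K) * C" .
    have "cmod (\<Prod>i\<in>{1..j}. complex_of_real (1 / sqrt (real n)) ^ k i) = (1 / sqrt (real n)) ^ K"
      by (simp add: K_def power_sum norm_power prod_norm[symmetric] norm_divide)
    then have "cmod (joint_cumulant (M n) j (\<lambda>i \<omega>. mat_trace (ensemble_mat a n \<omega> ^\<^sub>m k i)))
        = (1 / sqrt (real n)) ^ K * cmod (\<Sum>w\<in>?W. ?c (\<lambda>p. w (fst p) (snd p)))"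
      by (simp only: joint_cumulant_traces[OF n k] norm_mult)
    also have "\<dots> \<le> (1 / sqrt (real n)) ^ K * (N * (sqrt (real n) ^ (K - 1) * ?\<alpha> ^ K) * C)"
      by (rule mult_left_mono[OF le]) simp
    also have "\<dots> = N * C * (?\<alpha> ^ K / sqrt (real n))"
    proof -
      \<comment> \<open>As \<open>K\<close> is positive, \<open>K - 1\<close> is not truncated, and
        cancelling leaves exactly one factor \<open>1 / sqrt n\<close>.\<close>
      obtain m where m: "K = Suc m" using K by (cases K) auto
      have "sqrt (real n) \<noteq> 0" using n by simp
      then show ?thesis by (simp add: m field_simps)
    qed
    finally show ?thesis .
  qed
  then show ?thesis unfolding K_def by blast
qed

end

theorem theorem2:
  fixes M :: "nat \<Rightarrow> 'w measure"
    and a :: "nat \<Rightarrow> nat \<times> nat \<Rightarrow> 'w \<Rightarrow> complex"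
    and R :: "nat \<Rightarrow> ((nat \<times> nat) \<times> (nat \<times> nat)) set"
    and s :: real and j :: nat and k :: "nat \<Rightarrow> nat"
  assumes "correlated_ensemble M a R s"
    and "\<And>\<epsilon>::real. \<epsilon> > 0 \<Longrightarrow> (\<lambda>n. real (alpha2 n (R n))) \<in> O(\<lambda>n. real n powr \<epsilon>)"
    and "j \<ge> 3" and "\<And>i. i \<in> {1..j} \<Longrightarrow> k i \<ge> 1"
  shows "(\<lambda>n. joint_cumulant (M n) j (\<lambda>i \<omega>. mat_trace (ensemble_mat a n \<omega> ^\<^sub>m k i))) \<in> o(\<lambda>_. 1)"
proof -
  interpret correlated_ensemble M a R s by fact
  define K where "K = (\<Sum>i\<in>{1..j}. k i)"
  have "k 1 \<le> K" unfolding K_def using assms(3) by (intro member_le_sum) auto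
  then have K: "K > 0" using assms(4)[of 1] assms(3) by simp
  obtain C where C: "\<And>n. n \<ge> 1 \<Longrightarrow> cmod (joint_cumulant (M n) j (\<lambda>i \<omega>. mat_trace (ensemble_mat a n \<omega> ^\<^sub>m k i)))
      \<le> C * (real (alpha2 n (R n)) ^ K / sqrt (real n))"
    using joint_cumulant_traces_bound[of j k] assms(3,4) unfolding K_def by blast
  let ?J = "\<lambda>n. joint_cumulant (M n) j (\<lambda>i \<omega>. mat_trace (ensemble_mat a n \<omega> ^\<^sub>m k i))"
  have "(\<lambda>n. cmod (?J n)) \<in> O(\<lambda>n. real (alpha2 n (R n)) ^ K / sqrt (real n))"
    by (rule bigoI[of _ C], rule eventually_sequentiallyI[of 1]) (use C in auto)
  \<comment> \<open>The exponent \<open>1 / (4 * K)\<close> makes the \<open>K\<close>-th power of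
    order \<open>n\<close> to the power \<open>1 / 4\<close>, which the square root still
    beats.\<close>
  also have "(\<lambda>n. real (alpha2 n (R n)) ^ K / sqrt (real n)) \<in> O(\<lambda>n. (real n powr (1 / (4 * K))) ^ K / sqrt (real n))"
    using K by (intro landau_o.big.divide_right landau_o.big_power assms(2)) (auto intro: eventually_sequentiallyI[of 1])
  also have "(\<lambda>n. (real n powr (1 / (4 * K))) ^ K / sqrt (real n)) \<in> \<Theta>(\<lambda>n. real n powr (1 / 4) / sqrt (real n))"
    by (rule bigthetaI_cong, rule eventually_sequentiallyI[of 1])
       (use K in \<open>simp add: powr_realpow[symmetric] powr_powr\<close>)
  also have "(\<lambda>n. real n powr (1 / 4) / sqrt (real n)) \<in> o(\<lambda>_. 1 :: real)"
    by real_asymp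
  finally have "(\<lambda>n. cmod (?J n)) \<longlonglongrightarrow> 0"
    by (auto dest: smalloD_tendsto)
  then have "?J \<longlonglongrightarrow> 0" by (rule tendsto_norm_zero_cancel)
  then show ?thesis by (intro smalloI_tendsto) auto
qed

end
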